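(* Let $n\ge 3$. For any $\epsilon>0$ there exists $\delta>0$ such that if $M\in \mathrm{RotSym}^\partial_n$ satisfies $$m_{\mathrm{ADM}}(M) \le \frac{1+\delta}{2}\left(\frac{|\partial M|}{\omega_{n-1}}\right)^{\frac{n-2}{n-1}},$$ then $$d_{\mathcal{L}}\left(M, M_{\mathrm{Sch}}^n(m_0,L)\right)<\epsilon,$$ where $m_0=\frac12\left(\frac{|\partial M|}{\omega_{n-1}}\right)^{\frac{n-2}{n-1}}$ and $L$ is the depth of $M$.
   Context: Notation: $\omega_{n-1}$ is the area of the standard unit sphere $S^{n-1}\subset\mathbb{R}^n$, $g_0$ is its standard metric, and $|\cdot|$ denotes $(n-1)$-dimensional area. The class $\mathrm{RotSym}^\partial_n$ ($n\ge3$): complete $n$-dimensional rotationally symmetric ($\mathrm{SO}(n)$-symmetric) smooth Riemannian manifolds $(M,g)$ of nonnegative scalar curvature whose boundary is connected, nonempty, and an outermost (and outer-minimizing) minimal hypersurface. In geodesic coordinates such an $M$ is $[0,\infty)\times S^{n-1}$ with $g=ds^2+r(s)^2g_0$, where $s$ is the distance from $\partial M$, $r:[0,\infty)\to(0,\infty)$ is smooth, $r'(0)=0$, $r'(s)>0$ for all $s>0$, and the scalar curvature $\frac{n-1}{r^2}\left((n-2)[1-(r')^2]-2rr''\right)$ is $\ge 0$. The symmetric spheres are the level sets of $s$. ADM mass: the Hawking mass of the symmetric sphere at distance $s$ is $m_H(s)=\frac{r(s)^{n-2}}{2}\left(1-r'(s)^2\right)$, which is nondecreasing in $s$, and $m_{\mathrm{ADM}}(M)=\lim_{s\to\infty}m_H(s)\in[0,\infty]$.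 Appended Schwarzschild space: for $m>0$, $M_{\mathrm{Sch}}^n(m)$ is the part of the $n$-dimensional Riemannian Schwarzschild space of mass $m$ outside its outermost minimal hypersurface, i.e. $[(2m)^{1/(n-2)},\infty)\times S^{n-1}$ with metric $\left(1-\frac{2m}{r^{n-2}}\right)^{-1}dr^2+r^2g_0$ (extended across the boundary sphere in geodesic coordinates). For $L\in[0,\infty)$, $M_{\mathrm{Sch}}^n(m,L)$ is $M_{\mathrm{Sch}}^n(m)$ with the cylinder $[-L,0]\times S^{n-1}$, with metric $dz^2+(2m)^{2/(n-2)}g_0$, glued along $\{0\}\times S^{n-1}$ to $\partial M_{\mathrm{Sch}}^n(m)$ (for $L=0$ it is $M_{\mathrm{Sch}}^n(m)$). Depth: let $M\in\mathrm{RotSym}^\partial_n$ have finite ADM mass. Put $m_0=\frac12\left(\frac{|\partial M|}{\omega_{n-1}}\right)^{\frac{n-2}{n-1}}$, $r_0=r(0)=(2m_0)^{1/(n-2)}$, let $\delta_M\ge0$ be defined by $m_{\mathrm{ADM}}(M)=(1+\delta_M)m_0$, and $r_{\delta_M}=(1+\sqrt{\delta_M})^{1/(n-2)}r_0$. Using $r$ as a coordinate on $M$, let $z(r)$ be the increasing function, unique up to an additive constant, with $1+\left(\frac{dz}{dr}\right)^2=\left(\frac{ds}{dr}\right)^2$; its graph is a Riemannian isometric embedding of $M$ into $\mathbb{R}^{n+1}$. Likewise $M_{\mathrm{Sch}}^n(m_0)$ embeds as the graph of $z_{\mathrm{Sch}}(r)$ with $z_{\mathrm{Sch}}(r_0)=0$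 and $\frac{dz_{\mathrm{Sch}}}{dr}=\sqrt{\frac{2m_0}{r^{n-2}-2m_0}}$. Fix the constant by $z(r_{\delta_M})=z_{\mathrm{Sch}}(r_{\delta_M})$. The depth of $M$ is $L:=-z(r_0)$ (one has $L\ge 0$). Lipschitz Distance between metric spaces $(X,d_X),(Y,d_Y)$: $d_{\mathcal{L}}(X,Y)=\inf\{|\log \mathrm{dil}(\varphi)|+|\log\mathrm{dil}(\varphi^{-1})|\}$, the infimum over bi-Lipschitz maps (Lipschitz bijections with Lipschitz inverse) $\varphi:X\to Y$, where $\mathrm{dil}(\varphi)=\sup_{x_1\ne x_2}\frac{d_Y(\varphi(x_1),\varphi(x_2))}{d_X(x_1,x_2)}$. Riemannian manifolds are regarded as metric spaces with their Riemannian distance.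
   Formalization: The formal statement also assumes that the radius r_{δ_M} is attained on M (automatic if r is unbounded); otherwise, e.g. r(s)=1+ηs²/(1+s²) with small η, M satisfies the listed conditions but its depth L is undefined. *)

theory Defs
  imports "HOL-Analysis.Analysis"
begin

section \<open>Lipschitz distance\<close>

definition lipschitz_map :: "'a set \<Rightarrow> ('a \<Rightarrow> 'a \<Rightarrow> real) \<Rightarrow> ('b \<Rightarrow> 'b \<Rightarrow> real) \<Rightarrow> ('a \<Rightarrow> 'b) \<Rightarrow> bool" where
  "lipschitz_map X dX dY \<phi> \<longleftrightarrow> (\<exists>B. \<forall>x\<in>X. \<forall>y\<in>X. dY (\<phi> x) (\<phi> y) \<le> B * dX x y)"

definition dil :: "'a set \<Rightarrow> ('a \<Rightarrow> 'a \<Rightarrow> real) \<Rightarrow> ('b \<Rightarrow> 'b \<Rightarrow> real) \<Rightarrow> ('a \<Rightarrow> 'b) \<Rightarrow> real" where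
  "dil X dX dY \<phi> = Sup {dY (\<phi> x) (\<phi> y) / dX x y | x y. x \<in> X \<and> y \<in> X \<and> x \<noteq> y}"

definition bilipschitz_maps ::
  "'a set \<Rightarrow> ('a \<Rightarrow> 'a \<Rightarrow> real) \<Rightarrow> 'b set \<Rightarrow> ('b \<Rightarrow> 'b \<Rightarrow> real) \<Rightarrow> ('a \<Rightarrow> 'b) set" where
  "bilipschitz_maps X dX Y dY =
     {\<phi>. bij_betw \<phi> X Y \<and> lipschitz_map X dX dY \<phi> \<and> lipschitz_map Y dY dX (the_inv_into X \<phi>)}"

text \<open>Extended-real valued, so that the distance is \<open>\<infinity>\<close> when there is no bi-Lipschitz map.\<close>

definition lipschitz_distance ::
  "'a set \<Rightarrow> ('a \<Rightarrow> 'a \<Rightarrow> real) \<Rightarrow> 'b set \<Rightarrow> ('b \<Rightarrow> 'b \<Rightarrow> real) \<Rightarrow> ereal" where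
  "lipschitz_distance X dX Y dY =
     (INF \<phi>\<in>bilipschitz_maps X dX Y dY.
        ereal (\<bar>ln (dil X dX dY \<phi>)\<bar> + \<bar>ln (dil Y dY dX (the_inv_into X \<phi>))\<bar>))"

section \<open>Rotationally symmetric spaces \<open>ds\<^sup>2 + \<rho>(s)\<^sup>2 g\<^sub>0\<close> on \<open>[a, \<infinity>) \<times> S\<^bsup>n-1\<^esup>\<close>\<close>

definition rot_space :: "real \<Rightarrow> (real \<times> (real ^ 'n)) set" where
  "rot_space a = {a..} \<times> sphere 0 1"

text \<open>The standard metric of the unit sphere is induced from Euclidean space, so the length of
  the angular velocity is its Euclidean norm.\<close>

definition rot_speed :: "(real \<Rightarrow> real) \<Rightarrow> (real \<Rightarrow> real \<times> (real ^ 'n)) \<Rightarrow> real \<Rightarrow> real" where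
  "rot_speed \<rho> \<gamma> t =
     (let v = vector_derivative \<gamma> (at t)
      in sqrt ((fst v)\<^sup>2 + (\<rho> (fst (\<gamma> t)))\<^sup>2 * (norm (snd v))\<^sup>2))"

text \<open>A \<^const>\<open>valid_path\<close> is continuous and \<open>C\<^sup>1\<close> off a finite set, but its derivative may be
  unbounded near that set. Paths of infinite length, for which \<^const>\<open>integral\<close> would be \<open>0\<close>,
  therefore have to be excluded explicitly.\<close>

definition rot_curves ::
  "real \<Rightarrow> (real \<Rightarrow> real) \<Rightarrow> real \<times> (real ^ 'n) \<Rightarrow> real \<times> (real ^ 'n) \<Rightarrow> (real \<Rightarrow> real \<times> (real ^ 'n)) set" where
  "rot_curves a \<rho> p q =
     {\<gamma>. valid_path \<gamma> \<and> path_image \<gamma> \<subseteq> rot_space a \<and> pathstart \<gamma> = p \<and> pathfinish \<gamma> = q \<and>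
         rot_speed \<rho> \<gamma> integrable_on {0..1}}"

definition rot_dist ::
  "real \<Rightarrow> (real \<Rightarrow> real) \<Rightarrow> real \<times> (real ^ 'n) \<Rightarrow> real \<times> (real ^ 'n) \<Rightarrow> real" where
  "rot_dist a \<rho> p q = (INF \<gamma>\<in>rot_curves a \<rho> p q. integral {0..1} (rot_speed \<rho> \<gamma>))"

section \<open>The class of rotationally symmetric manifolds\<close>

text \<open>A manifold of the class is represented by its profile \<open>r\<close>, of which only the values on
  \<open>[0, \<infinity>)\<close> matter; derivatives at the boundary point \<open>0\<close> are one-sided.\<close>

definition hderiv :: "(real \<Rightarrow> real) \<Rightarrow> real \<Rightarrow> real" where
  "hderiv f s = vector_derivative f (at s within {0..})"

definition smooth_halfline :: "(real \<Rightarrow> real) \<Rightarrow> bool" where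
  "smooth_halfline f \<longleftrightarrow> (\<forall>k. \<forall>s\<ge>0. (hderiv ^^ k) f differentiable (at s within {0..}))"

definition scalar_curvature :: "nat \<Rightarrow> (real \<Rightarrow> real) \<Rightarrow> real \<Rightarrow> real" where
  "scalar_curvature n r s =
     (real n - 1) / (r s)\<^sup>2 *
       ((real n - 2) * (1 - (hderiv r s)\<^sup>2) - 2 * r s * hderiv (hderiv r) s)"

definition RotSym :: "nat \<Rightarrow> (real \<Rightarrow> real) \<Rightarrow> bool" where
  "RotSym n r \<longleftrightarrow>
     smooth_halfline r \<and> (\<forall>s\<ge>0. r s > 0) \<and> hderiv r 0 = 0 \<and> (\<forall>s>0. hderiv r s > 0) \<and>
     (\<forall>s\<ge>0. scalar_curvature n r s \<ge> 0)"

definition hawking_mass :: "nat \<Rightarrow> (real \<Rightarrow> real) \<Rightarrow> real \<Rightarrow> real" where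
  "hawking_mass n r s = r s ^ (n - 2) / 2 * (1 - (hderiv r s)\<^sup>2)"

definition ADM_mass :: "nat \<Rightarrow> (real \<Rightarrow> real) \<Rightarrow> ereal" where
  "ADM_mass n r = Lim at_top (\<lambda>s. ereal (hawking_mass n r s))"

text \<open>The area of the unit sphere of \<open>\<real>\<^sup>n\<close> is \<open>n\<close> times the volume of the unit ball.\<close>

definition unit_sphere_area :: "nat \<Rightarrow> real" where
  "unit_sphere_area n = real n * unit_ball_vol (real n)"

definition boundary_area :: "nat \<Rightarrow> (real \<Rightarrow> real) \<Rightarrow> real" where
  "boundary_area n r = unit_sphere_area n * r 0 ^ (n - 1)"

definition boundary_mass :: "nat \<Rightarrow> (real \<Rightarrow> real) \<Rightarrow> real" where
  "boundary_mass n r =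
     1 / 2 * (boundary_area n r / unit_sphere_area n) powr ((real n - 2) / (real n - 1))"

section \<open>Appended Schwarzschild space\<close>

definition sch_radius :: "nat \<Rightarrow> real \<Rightarrow> real" where
  "sch_radius n m = (2 * m) powr (1 / (real n - 2))"

text \<open>Distance to the horizon of the sphere of area radius \<open>x\<close>; the integrand is unbounded but
  integrable at the horizon.\<close>

definition sch_arclength :: "nat \<Rightarrow> real \<Rightarrow> real \<Rightarrow> real" where
  "sch_arclength n m x = integral {sch_radius n m..x} (\<lambda>t. 1 / sqrt (1 - 2 * m / t ^ (n - 2)))"

definition sch_profile :: "nat \<Rightarrow> real \<Rightarrow> real \<Rightarrow> real" where
  "sch_profile n m = the_inv_into {sch_radius n m..} (sch_arclength n m)"

text \<open>Profile, on \<open>[-L, \<infinity>)\<close>, of Schwarzschild space in geodesic coordinates with a cylinder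
  of length \<open>L\<close> glued to its horizon \<open>s = 0\<close>.\<close>

definition appended_sch_profile :: "nat \<Rightarrow> real \<Rightarrow> real \<Rightarrow> real" where
  "appended_sch_profile n m s = (if s \<le> 0 then sch_radius n m else sch_profile n m s)"

section \<open>Depth\<close>

definition mass_excess :: "nat \<Rightarrow> (real \<Rightarrow> real) \<Rightarrow> real" where
  "mass_excess n r = real_of_ereal (ADM_mass n r) / boundary_mass n r - 1"

definition matching_radius :: "nat \<Rightarrow> (real \<Rightarrow> real) \<Rightarrow> real" where
  "matching_radius n r = (1 + sqrt (mass_excess n r)) powr (1 / (real n - 2)) * r 0"

definition sch_height :: "nat \<Rightarrow> real \<Rightarrow> real \<Rightarrow> real" where
  "sch_height n m x =
     integral {sch_radius n m..x} (\<lambda>t. sqrt (2 * m / (t ^ (n - 2) - 2 * m)))"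

text \<open>The increasing functions \<open>z\<close> of the area radius whose graph is isometric to the manifold.
  Here \<open>s\<close> is the geodesic coordinate as a function of the area radius; it has infinite slope
  at \<open>r 0\<close>, where \<open>z\<close> is only required to be continuous.\<close>

definition height_function :: "(real \<Rightarrow> real) \<Rightarrow> (real \<Rightarrow> real) \<Rightarrow> bool" where
  "height_function r z \<longleftrightarrow>
     continuous_on (r ` {0..}) z \<and> mono_on (r ` {0..}) z \<and>
     (let s = the_inv_into {0..} r
      in \<forall>x\<in>r ` {0<..}. z differentiable (at x) \<and> 1 + (deriv z x)\<^sup>2 = (deriv s x)\<^sup>2)"

text \<open>Meaningful when the matching radius lies in \<open>r ` {0..}\<close>, where \<open>z\<close> is defined;
  this is automatic if \<open>r\<close> is unbounded.\<close>

definition depth :: "nat \<Rightarrow> (real \<Rightarrow> real) \<Rightarrow> real" where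
  "depth n r =
     (THE L. \<exists>z. height_function r z \<and>
                 z (matching_radius n r) = sch_height n (boundary_mass n r) (matching_radius n r) \<and>
                 L = - z (r 0))"

end

theory Submission
  imports Defs
begin

text \<open>Let \<open>m\<close> be the boundary mass of \<open>M\<close>, \<open>\<sigma>(x) = sqrt (1 - 2 m / x ^ (n - 2))\<close> the slope \<open>dx/ds\<close>
  of the area radius \<open>x\<close> in Schwarzschild space of mass \<open>m\<close>, and \<open>d\<close> the relative mass excess of \<open>M\<close>.
  Nonnegative scalar curvature makes the Hawking mass nondecreasing, so along \<open>M\<close> it stays between
  \<open>m\<close> and \<open>(1 + d) m\<close>. Since \<open>r'\<^sup>2 = 1 - 2 m\<^sub>H / r ^ (n - 2)\<close>, this says \<open>r' \<le> \<sigma>(r)\<close> everywhere and, beyond the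
  matching radius \<open>x\<^sub>d\<close> with \<open>x\<^sub>d ^ (n - 2) = (1 + sqrt d) 2 m\<close>, also \<open>r' \<ge> (1 - sqrt d) \<sigma>(r)\<close>
  (\<open>hderiv_le_sch_slope\<close>, \<open>hderiv_ge_sch_slope\<close>).

  Outside the matching sphere, \<open>M\<close> is therefore compared with Schwarzschild space by identifying
  symmetric spheres of equal area: tangential lengths agree and radial lengths are
  changed by the factor \<open>r' / \<sigma>(r)\<close>, which is close to \<open>1\<close>. Inside it, all area radii, on both sides, lie between
  \<open>r 0\<close> and \<open>(1 + sqrt d) r 0\<close>, so that only radial lengths matter. There the two radial lengths are
  \<open>s\<^sub>1\<close>, the distance of the matching sphere from the boundary of \<open>M\<close>, and \<open>L + A(x\<^sub>d)\<close>, where \<open>A\<close> is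
  Schwarzschild arc length. For a graph of slope \<open>z'\<close> over the area radius, arc length minus height is
  the integral of \<open>sqrt (1 + z'\<^sup>2) - z'\<close>, which decreases in \<open>z'\<close> and is at most
  \<open>1 / sqrt (1 + z'\<^sup>2)\<close>. Depth being a difference of heights, it follows that
  \<open>0 \<le> L + A(x\<^sub>d) - s\<^sub>1 \<le> \<sigma>(x\<^sub>d) s\<^sub>1\<close> (\<open>length_mismatch\<close>), and \<open>\<sigma>(x\<^sub>d)\<close> is at most the fourth
  root of \<open>d\<close>. So the two radial lengths have ratio close to \<open>1\<close>, however long the neck is.

  The two radial maps are glued to a \<open>C\<^sup>1\<close> map: a radial map with a kink would
  destroy piecewise smoothness of curves that cross the kink infinitely often. On the inner part the radial
  coordinate is accordingly a quadratic polynomial, whose derivative is affine with average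
  \<open>(L + A(x\<^sub>d)) / s\<^sub>1\<close> and with the value at \<open>s\<^sub>1\<close> that the outer part prescribes. A \<open>C\<^sup>1\<close> radial map that changes
  radial and tangential lengths by factors in \<open>[1/K, K]\<close> shows that the Lipschitz distance is at
  most \<open>2 ln K\<close> (\<open>radial_map_lipschitz_distance\<close>).\<close>

section \<open>Real functions of one variable\<close>

text \<open>Speeds of piecewise \<open>C\<^sup>1\<close> curves and the arc length density at the horizon are continuous off a
  finite set but may be unbounded; this is the integrability criterion for both.\<close>

lemma integrable_dominated_off_finite:
  fixes f g :: "real \<Rightarrow> real"
  assumes "finite S" and f: "continuous_on ({a..b} - S) f" and g: "g integrable_on {a..b}"
    and le: "\<And>x. x \<in> {a..b} - S \<Longrightarrow> \<bar>f x\<bar> \<le> g x"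
  shows "f integrable_on {a..b}"
proof -
  have neg: "negligible ((({a..b} - S) - {a..b}) \<union> ({a..b} - ({a..b} - S)))"
    using negligible_finite[OF \<open>finite S\<close>] by (rule negligible_subset) auto
  have meas: "{a..b} - S \<in> sets lebesgue"
    using negligible_imp_sets[OF negligible_finite[OF \<open>finite S\<close>]] by (intro sets.Diff) auto
  have "f integrable_on ({a..b} - S)"
  proof (rule measurable_bounded_by_integrable_imp_integrable)
    show "f \<in> borel_measurable (lebesgue_on ({a..b} - S))"
      by (rule continuous_imp_measurable_on_sets_lebesgue[OF f meas])
    show "g integrable_on ({a..b} - S)"
      using g integrable_spike_set_eq[OF neg] by blast
  qed (use le meas in auto)
  then show ?thesis
    using integrable_spike_set_eq[OF neg] by blast
qed

lemma continuous_on_halfline: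
  fixes f :: "real \<Rightarrow> 'a::topological_space"
  assumes "\<And>b. continuous_on {a..b} f"
  shows "continuous_on {a..} f"
  unfolding continuous_on_eq_continuous_within
proof
  fix x assume x: "x \<in> {a..}"
  have "at x within {a..} = at x within {a..x + 1}"
    by (rule at_within_nhd[of _ "{..<x + 1}"]) auto
  then show "continuous (at x within {a..}) f"
    using assms[of "x + 1"] x by (simp add: continuous_on_eq_continuous_within)
qed

text \<open>Near the horizon the densities of arc length and of height blow up like the inverse square root of
  the distance \<open>t - R\<close>, which has the primitive \<open>2 sqrt (t - R)\<close>.\<close>

lemma
  fixes f :: "real \<Rightarrow> real"
  assumes "0 \<le> R" and cont: "continuous_on {R<..} f"
    and bound: "\<And>t. t > R \<Longrightarrow> \<bar>f t\<bar> \<le> sqrt (t / (t - R))"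
  shows endpoint_singular_integrable: "f integrable_on {R..x}"
    and endpoint_singular_deriv:
      "x > R \<Longrightarrow> ((\<lambda>x. integral {R..x} f) has_real_derivative f x) (at x)"
    and endpoint_singular_continuous: "continuous_on {R..} (\<lambda>x. integral {R..x} f)"
proof -
  show int: "f integrable_on {R..x}" for x
  proof (cases "R < x")
    case True
    have "((\<lambda>t. sqrt x / sqrt (t - R)) has_integral
        2 * sqrt x * sqrt (x - R) - 2 * sqrt x * sqrt (R - R)) {R..x}"
    proof (rule fundamental_theorem_of_calculus_interior)
      show "((\<lambda>t. 2 * sqrt x * sqrt (t - R)) has_vector_derivative sqrt x / sqrt (t - R)) (at t)"
        if "t \<in> {R<..<x}" for t
        unfolding has_real_derivative_iff_has_vector_derivative[symmetric]
        using that by (auto intro!: derivative_eq_intros simp: field_simps)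
    qed (use True in \<open>auto intro!: continuous_intros\<close>)
    then have g: "(\<lambda>t. sqrt x / sqrt (t - R)) integrable_on {R..x}" by blast
    show ?thesis
    proof (rule integrable_dominated_off_finite[OF _ _ g, of "{R}"])
      show "continuous_on ({R..x} - {R}) f" by (rule continuous_on_subset[OF cont]) auto
      show "\<bar>f t\<bar> \<le> sqrt x / sqrt (t - R)" if "t \<in> {R..x} - {R}" for t
      proof -
        have "sqrt (t / (t - R)) \<le> sqrt (x / (t - R))"
          using that by (intro real_sqrt_le_mono divide_right_mono) auto
        then show ?thesis using bound[of t] that by (simp add: real_sqrt_divide)
      qed
    qed simp
  next
    case False
    then show ?thesis using integrable_on_refl[of f R] by (cases "x = R") auto
  qed
  show "((\<lambda>x. integral {R..x} f) has_real_derivative f x) (at x)" if x: "x > R"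
  proof -
    have eq: "at x within ({R..x + 1} - {R}) = at x"
      by (rule at_within_interior) (use x in \<open>auto simp: interior_open
          intro!: interiorI[of "{R<..<x+1}"]\<close>)
    have "continuous (at x within ({R..x + 1} - {R})) f"
      unfolding eq using cont x by (simp add: continuous_on_eq_continuous_at)
    from integral_has_vector_derivative_continuous_at[OF int _ _ this] x show ?thesis
      unfolding eq by (simp add: has_real_derivative_iff_has_vector_derivative)
  qed
  show "continuous_on {R..} (\<lambda>x. integral {R..x} f)"
    by (rule continuous_on_halfline) (rule indefinite_integral_continuous_1[OF int])
qed

lemma DERIV_left_inverse:
  fixes f g :: "real \<Rightarrow> real"
  assumes "open S" "x \<in> S" "continuous_on S f" "\<And>z. z \<in> S \<Longrightarrow> g (f z) = z"
    and "(f has_real_derivative D) (at x)" "D \<noteq> 0"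
  shows "(g has_real_derivative inverse D) (at (f x))"
  unfolding has_field_derivative_def
  by (rule has_derivative_inverse_strong[OF assms(1-4) assms(5)[unfolded has_field_derivative_def]])
     (use assms(6) in auto)

text \<open>The one-sided difference quotients of the glued function are those of its two pieces.\<close>

lemma DERIV_If_le:
  fixes g h :: "real \<Rightarrow> real"
  assumes "(g has_real_derivative D) (at c)" "(h has_real_derivative D) (at c)" "g c = h c"
  shows "((\<lambda>x. if x \<le> c then g x else h x) has_real_derivative D) (at c)"
proof -
  let ?f = "\<lambda>x. if x \<le> c then g x else h x"
  have g: "((\<lambda>y. (g y - g c) / (y - c)) \<longlongrightarrow> D) (at c)"
    and h: "((\<lambda>y. (h y - h c) / (y - c)) \<longlongrightarrow> D) (at c)"
    using assms by (auto simp: has_field_derivative_iff)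
  have "((\<lambda>y. (?f y - ?f c) / (y - c)) \<longlongrightarrow> D) (at_left c)"
    by (rule Lim_transform_eventually[OF tendsto_within_subset[OF g subset_UNIV]])
       (auto simp: eventually_at_filter)
  moreover have "((\<lambda>y. (?f y - ?f c) / (y - c)) \<longlongrightarrow> D) (at_right c)"
    by (rule Lim_transform_eventually[OF tendsto_within_subset[OF h subset_UNIV]])
       (use assms(3) in \<open>auto simp: eventually_at_filter\<close>)
  ultimately show ?thesis
    unfolding has_field_derivative_iff by (simp add: filterlim_at_split)
qed

section \<open>Lengths of curves in rotationally symmetric spaces\<close>

lemma rot_speed_nonneg: "0 \<le> rot_speed \<rho> \<gamma> t"
  by (simp add: rot_speed_def Let_def)

lemma rot_length_nonneg: "0 \<le> integral {0..1} (rot_speed \<rho> \<gamma>)"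
proof (cases "rot_speed \<rho> \<gamma> integrable_on {0..1}")
  case True
  then show ?thesis by (rule integral_nonneg) (simp add: rot_speed_nonneg)
qed (simp add: not_integrable_integral)

lemma rot_dist_le_length:
  "\<gamma> \<in> rot_curves a \<rho> p q \<Longrightarrow> rot_dist a \<rho> p q \<le> integral {0..1} (rot_speed \<rho> \<gamma>)"
  unfolding rot_dist_def
  by (rule cINF_lower) (auto intro!: bdd_belowI[of _ 0] rot_length_nonneg)

lemma valid_path_vector_derivative:
  assumes "valid_path \<gamma>"
  obtains S D where "finite S"
    "\<And>t. t \<in> {0..1} - S \<Longrightarrow> (\<gamma> has_vector_derivative D t) (at t)"
    "continuous_on ({0..1} - S) D" "continuous_on {0..1} \<gamma>"
  using assms unfolding valid_path_def piecewise_C1_differentiable_on_def C1_differentiable_on_def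
  by blast

text \<open>The speed dominates the derivative of the radial coordinate. In particular points at different
  distances from the boundary have positive distance, so that dilatations can be bounded from below.\<close>

lemma radial_distance_le_length:
  assumes \<gamma>: "\<gamma> \<in> rot_curves a \<rho> p q"
  shows "\<bar>fst q - fst p\<bar> \<le> integral {0..1} (rot_speed \<rho> \<gamma>)"
proof -
  have vp: "valid_path \<gamma>" and int: "rot_speed \<rho> \<gamma> integrable_on {0..1}"
    and ends: "\<gamma> 0 = p" "\<gamma> 1 = q"
    using \<gamma> by (auto simp: rot_curves_def pathstart_def pathfinish_def)
  from vp obtain S D where S: "finite S"
    "\<And>t. t \<in> {0..1} - S \<Longrightarrow> (\<gamma> has_vector_derivative D t) (at t)"
    "continuous_on {0..1} \<gamma>"
    by (rule valid_path_vector_derivative) blast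
  have "((\<lambda>t. fst (vector_derivative \<gamma> (at t))) has_integral (fst (\<gamma> 1) - fst (\<gamma> 0))) {0..1}"
  proof (rule fundamental_theorem_of_calculus_interior_strong[OF S(1)])
    show "((\<lambda>t. fst (\<gamma> t)) has_vector_derivative fst (vector_derivative \<gamma> (at t))) (at t)"
      if "t \<in> {0<..<1} - S" for t
    proof -
      have "(\<gamma> has_vector_derivative D t) (at t)" using S(2) that by auto
      then show ?thesis
        using bounded_linear.has_vector_derivative[OF bounded_linear_fst] vector_derivative_at
        by metis
    qed
    show "continuous_on {0..1} (\<lambda>t. fst (\<gamma> t))"
      by (intro continuous_intros S)
  qed auto
  then have *: "(\<lambda>t. fst (vector_derivative \<gamma> (at t))) integrable_on {0..1}"
    "integral {0..1} (\<lambda>t. fst (vector_derivative \<gamma> (at t))) = fst q - fst p"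
    using ends by (auto simp: has_integral_iff)
  have "norm (integral {0..1} (\<lambda>t. fst (vector_derivative \<gamma> (at t))))
      \<le> integral {0..1} (rot_speed \<rho> \<gamma>)"
  proof (rule integral_norm_bound_integral[OF *(1) int])
    show "norm (fst (vector_derivative \<gamma> (at t))) \<le> rot_speed \<rho> \<gamma> t" for t
      unfolding rot_speed_def Let_def by (rule real_le_rsqrt) simp
  qed
  then show ?thesis using * by simp
qed

text \<open>The map \<open>apfst f\<close> multiplies the radial velocity by \<open>f'\<close> and replaces the radius \<open>\<rho>\<close> by \<open>\<sigma> \<circ> f\<close>.
  If both factors are at most \<open>K\<close>, so is the stretch of every curve. Two-sided differentiability of \<open>f\<close> also at \<open>a\<close>
  lets the chain rule apply where a curve touches the boundary.\<close>

lemma rot_curve_transport: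
  fixes p q :: "real \<times> (real ^ 'n)"
  assumes \<gamma>: "\<gamma> \<in> rot_curves a \<rho> p q"
    and d: "\<And>s. s \<ge> a \<Longrightarrow> (f has_real_derivative f' s) (at s)"
    and f': "continuous_on {a..} f'"
    and le_f: "\<And>s. s \<ge> a \<Longrightarrow> b \<le> f s"
    and K: "\<And>s. s \<ge> a \<Longrightarrow> \<bar>f' s\<bar> \<le> K"
    and \<sigma>: "\<And>s. s \<ge> a \<Longrightarrow> \<bar>\<sigma> (f s)\<bar> \<le> K * \<bar>\<rho> s\<bar>"
    and cont: "continuous_on {a..} (\<lambda>s. \<sigma> (f s))"
  shows "\<exists>\<gamma>'\<in>rot_curves b \<sigma> (apfst f p) (apfst f q).
           integral {0..1} (rot_speed \<sigma> \<gamma>') \<le> K * integral {0..1} (rot_speed \<rho> \<gamma>)"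
proof -
  have vp: "valid_path \<gamma>" and int: "rot_speed \<rho> \<gamma> integrable_on {0..1}"
    and im: "path_image \<gamma> \<subseteq> rot_space a"
    and ends: "\<gamma> 0 = p" "\<gamma> 1 = q"
    using \<gamma> by (auto simp: rot_curves_def pathstart_def pathfinish_def)
  have in_space: "fst (\<gamma> t) \<ge> a" "norm (snd (\<gamma> t)) = 1" if "t \<in> {0..1}" for t
  proof -
    have "\<gamma> t \<in> rot_space a" using im that by (auto simp: path_image_def)
    then show "fst (\<gamma> t) \<ge> a" "norm (snd (\<gamma> t)) = 1" by (auto simp: rot_space_def)
  qed
  have K0: "K \<ge> 0" using K[of a] by linarith
  from vp obtain S D where S: "finite S"
    "\<And>t. t \<in> {0..1} - S \<Longrightarrow> (\<gamma> has_vector_derivative D t) (at t)"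
    "continuous_on ({0..1} - S) D" and c\<gamma>: "continuous_on {0..1} \<gamma>"
    by (rule valid_path_vector_derivative) blast
  define \<gamma>' where "\<gamma>' = (\<lambda>t. (f (fst (\<gamma> t)), snd (\<gamma> t)))"
  define D' where "D' = (\<lambda>t. (f' (fst (\<gamma> t)) * fst (D t), snd (D t)))"
  have c\<gamma>S: "continuous_on ({0..1} - S) \<gamma>"
    by (rule continuous_on_subset[OF c\<gamma>]) auto
  have D': "(\<gamma>' has_vector_derivative D' t) (at t)" if t: "t \<in> {0..1} - S" for t
  proof -
    have "((\<lambda>t. fst (\<gamma> t)) has_vector_derivative fst (D t)) (at t)"
      using bounded_linear.has_vector_derivative[OF bounded_linear_fst S(2)[OF t]] .
    moreover have "(f has_field_derivative f' (fst (\<gamma> t))) (at (fst (\<gamma> t)))"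
      using d in_space(1) t by blast
    ultimately have "((f \<circ> (\<lambda>t. fst (\<gamma> t))) has_vector_derivative
        (fst (D t) * f' (fst (\<gamma> t)))) (at t)"
      by (rule field_vector_diff_chain_at)
    moreover have "((\<lambda>t. snd (\<gamma> t)) has_vector_derivative snd (D t)) (at t)"
      using bounded_linear.has_vector_derivative[OF bounded_linear_snd S(2)[OF t]] .
    ultimately show ?thesis
      unfolding \<gamma>'_def D'_def
      using has_vector_derivative_Pair by (fastforce simp: o_def mult.commute)
  qed
  have cf': "continuous_on ({0..1} - S) (\<lambda>t. f' (fst (\<gamma> t)))"
    by (rule continuous_on_compose2[OF f']) (use c\<gamma>S in_space in \<open>auto intro: continuous_intros\<close>)
  have cf: "continuous_on {a..} f"
    using d by (meson DERIV_continuous atLeast_iff continuous_at_imp_continuous_on)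
  have cD': "continuous_on ({0..1} - S) D'"
    unfolding D'_def by (intro continuous_intros cf' S)
  have c\<gamma>': "continuous_on {0..1} \<gamma>'"
    unfolding \<gamma>'_def
    by (intro continuous_intros c\<gamma> continuous_on_compose2[OF cf]) (use in_space in auto)
  have vp': "valid_path \<gamma>'"
    unfolding valid_path_def piecewise_C1_differentiable_on_def C1_differentiable_on_def
    using c\<gamma>' S(1) D' cD' by blast
  have speed: "rot_speed \<rho> \<gamma> t = sqrt ((fst (D t))\<^sup>2 + (\<rho> (fst (\<gamma> t)))\<^sup>2 * (norm (snd (D t)))\<^sup>2)"
    "rot_speed \<sigma> \<gamma>' t = sqrt ((f' (fst (\<gamma> t)) * fst (D t))\<^sup>2 + (\<sigma> (f (fst (\<gamma> t))))\<^sup>2 * (norm (snd (D t)))\<^sup>2)"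
    if "t \<in> {0..1} - S" for t
    using vector_derivative_at[OF S(2)[OF that]] vector_derivative_at[OF D'[OF that]]
    by (simp_all add: rot_speed_def Let_def D'_def \<gamma>'_def)
  have le: "rot_speed \<sigma> \<gamma>' t \<le> K * rot_speed \<rho> \<gamma> t" if t: "t \<in> {0..1} - S" for t
  proof -
    have a: "fst (\<gamma> t) \<ge> a" using in_space t by auto
    have 1: "(f' (fst (\<gamma> t)))\<^sup>2 \<le> K\<^sup>2"
      using K[OF a] K0 by (simp add: abs_le_square_iff[symmetric])
    have 2: "(\<sigma> (f (fst (\<gamma> t))))\<^sup>2 \<le> (K * \<rho> (fst (\<gamma> t)))\<^sup>2"
      using \<sigma>[OF a] K0 by (simp add: abs_le_square_iff[symmetric] abs_mult)
    have "(f' (fst (\<gamma> t)) * fst (D t))\<^sup>2 + (\<sigma> (f (fst (\<gamma> t))))\<^sup>2 * (norm (snd (D t)))\<^sup>2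
        \<le> K\<^sup>2 * (fst (D t))\<^sup>2 + (K * \<rho> (fst (\<gamma> t)))\<^sup>2 * (norm (snd (D t)))\<^sup>2"
      using mult_right_mono[OF 1, of "(fst (D t))\<^sup>2"] mult_right_mono[OF 2, of "(norm (snd (D t)))\<^sup>2"]
      by (simp add: power_mult_distrib)
    also have "\<dots> = K\<^sup>2 * ((fst (D t))\<^sup>2 + (\<rho> (fst (\<gamma> t)))\<^sup>2 * (norm (snd (D t)))\<^sup>2)"
      by (simp add: power_mult_distrib algebra_simps)
    finally show ?thesis
      using K0 by (simp add: speed[OF t] real_sqrt_le_iff real_sqrt_mult
          flip: real_sqrt_le_iff[of _ "K\<^sup>2 * _"])
  qed
  have c\<sigma>: "continuous_on ({0..1} - S) (\<lambda>t. \<sigma> (f (fst (\<gamma> t))))"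
    by (rule continuous_on_compose2[OF cont]) (use c\<gamma>S in_space in \<open>auto intro: continuous_intros\<close>)
  have intK: "(\<lambda>t. K * rot_speed \<rho> \<gamma> t) integrable_on {0..1}"
    using int by (rule integrable_on_mult_right)
  have int': "rot_speed \<sigma> \<gamma>' integrable_on {0..1}"
  proof (rule integrable_dominated_off_finite[OF S(1) _ intK])
    have "continuous_on ({0..1} - S)
        (\<lambda>t. sqrt ((f' (fst (\<gamma> t)) * fst (D t))\<^sup>2 + (\<sigma> (f (fst (\<gamma> t))))\<^sup>2 * (norm (snd (D t)))\<^sup>2))"
      by (intro continuous_intros cf' c\<sigma> S)
    then show "continuous_on ({0..1} - S) (rot_speed \<sigma> \<gamma>')"
      by (subst continuous_on_cong[OF refl speed(2)])
    show "\<bar>rot_speed \<sigma> \<gamma>' t\<bar> \<le> K * rot_speed \<rho> \<gamma> t" if "t \<in> {0..1} - S" for t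
      using le[OF that] rot_speed_nonneg[of \<sigma> \<gamma>' t] by simp
  qed
  have len: "integral {0..1} (rot_speed \<sigma> \<gamma>') \<le> K * integral {0..1} (rot_speed \<rho> \<gamma>)"
  proof -
    have "integral {0..1} (rot_speed \<sigma> \<gamma>')
        = integral {0..1} (\<lambda>t. if t \<in> S then 0 else rot_speed \<sigma> \<gamma>' t)"
      by (rule integral_spike[OF negligible_finite[OF S(1)]]) auto
    also have "\<dots> \<le> integral {0..1} (\<lambda>t. K * rot_speed \<rho> \<gamma> t)"
    proof (rule integral_le[OF _ intK])
      show "(\<lambda>t. if t \<in> S then 0 else rot_speed \<sigma> \<gamma>' t) integrable_on {0..1}"
        by (rule integrable_spike[OF int' negligible_finite[OF S(1)]]) auto
      show "(if t \<in> S then 0 else rot_speed \<sigma> \<gamma>' t) \<le> K * rot_speed \<rho> \<gamma> t"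
        if "t \<in> {0..1}" for t
        using le[of t] that K0 rot_speed_nonneg[of \<rho> \<gamma> t] by auto
    qed
    finally show ?thesis by simp
  qed
  have "path_image \<gamma>' \<subseteq> rot_space b"
    using in_space le_f by (auto simp: path_image_def \<gamma>'_def rot_space_def)
  then have "\<gamma>' \<in> rot_curves b \<sigma> (apfst f p) (apfst f q)"
    using vp' int' ends unfolding rot_curves_def
    by (auto simp: pathstart_def pathfinish_def \<gamma>'_def apfst_def map_prod_def split_beta)
  with len show ?thesis by blast
qed

text \<open>Dimension at least two supplies a direction \<open>e\<close> also when \<open>v = u\<close> or \<open>v = - u\<close>.\<close>

lemma great_circle_through:
  fixes u v :: "real ^ 'n"
  assumes n: "CARD('n) \<ge> 2" and u: "norm u = 1" and v: "norm v = 1"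
  obtains e \<alpha> where "norm e = 1" "u \<bullet> e = 0" "v = cos \<alpha> *\<^sub>R u + sin \<alpha> *\<^sub>R e"
proof -
  define w where "w = v - (u \<bullet> v) *\<^sub>R u"
  have uu: "u \<bullet> u = 1" and vv: "v \<bullet> v = 1" using u v by (simp_all add: norm_eq_1)
  have uw: "u \<bullet> w = 0" by (simp add: w_def inner_diff_right uu)
  have ww: "(norm w)\<^sup>2 = 1 - (u \<bullet> v)\<^sup>2"
    unfolding power2_norm_eq_inner w_def
    by (simp add: inner_diff_right inner_diff_left uu vv inner_commute power2_eq_square)
  obtain e where e: "norm e = 1" "u \<bullet> e = 0" "w = norm w *\<^sub>R e"
  proof (cases "w = 0")
    case False
    then show ?thesis using that[of "w /\<^sub>R norm w"] uw by simp
  next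
    case True
    have "2 \<le> DIM(real ^ 'n)" using n by simp
    then obtain y where y: "y \<noteq> 0" "orthogonal u y"
      using orthogonal_to_vector_exists by blast
    then show ?thesis
      using that[of "y /\<^sub>R norm y"] True by (simp add: orthogonal_def)
  qed
  obtain \<alpha> where "u \<bullet> v = cos \<alpha>" "norm w = sin \<alpha>"
    using sincos_total_2pi[of "u \<bullet> v" "norm w"] ww by (metis add.commute diff_add_cancel)
  moreover have "v = (u \<bullet> v) *\<^sub>R u + w" by (simp add: w_def)
  ultimately show ?thesis using that[of e \<alpha>] e by simp
qed

text \<open>A curve with affine radial coordinate that runs along a great circle. Nonemptiness matters because
  the infimum of the empty set of reals is an unspecified number.\<close>

lemma rot_curves_nonempty:
  fixes p q :: "real \<times> (real ^ 'n)"
  assumes n: "CARD('n) \<ge> 2" and p: "p \<in> rot_space a" and q: "q \<in> rot_space a"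
    and \<rho>: "continuous_on {a..} \<rho>"
  shows "rot_curves a \<rho> p q \<noteq> {}"
proof -
  have np: "norm (snd p) = 1" and nq: "norm (snd q) = 1" and ap: "a \<le> fst p" and aq: "a \<le> fst q"
    using p q by (auto simp: rot_space_def)
  obtain e \<alpha> where e: "norm e = 1" "snd p \<bullet> e = 0"
      "snd q = cos \<alpha> *\<^sub>R snd p + sin \<alpha> *\<^sub>R e"
    using great_circle_through[OF n np nq] by blast
  define R where "R = (\<lambda>t. fst p + t * (fst q - fst p))"
  define \<gamma> where "\<gamma> = (\<lambda>t. (R t, cos (\<alpha> * t) *\<^sub>R snd p + sin (\<alpha> * t) *\<^sub>R e))"
  define D where "D = (\<lambda>t. (fst q - fst p,
     (- (\<alpha> * sin (\<alpha> * t))) *\<^sub>R snd p + (\<alpha> * cos (\<alpha> * t)) *\<^sub>R e))"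
  have D: "(\<gamma> has_vector_derivative D t) (at t)" for t
    unfolding \<gamma>_def D_def R_def
    by (auto intro!: has_vector_derivative_Pair derivative_eq_intros
        simp: has_vector_derivative_def scaleR_add_left algebra_simps)
  have cD: "continuous_on UNIV D"
    unfolding D_def by (intro continuous_intros)
  have vp: "valid_path \<gamma>"
    unfolding valid_path_def
  proof (rule C1_differentiable_imp_piecewise)
    show "\<gamma> C1_differentiable_on {0..1}"
      unfolding C1_differentiable_on_def using D continuous_on_subset[OF cD, of "{0..1}"] by blast
  qed
  have unit: "norm (snd (\<gamma> t)) = 1" for t
  proof -
    have "snd (\<gamma> t) \<bullet> snd (\<gamma> t) = (cos (\<alpha> * t))\<^sup>2 * (snd p \<bullet> snd p) + (sin (\<alpha> * t))\<^sup>2 * (e \<bullet> e)"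
      using e(2) by (simp add: \<gamma>_def inner_add_left inner_add_right inner_commute power2_eq_square)
    then show ?thesis using np e(1) by (simp add: norm_eq_1)
  qed
  have Rge: "R t \<ge> a" if "t \<in> {0..1}" for t
  proof -
    have "R t = (1 - t) * fst p + t * fst q" by (simp add: R_def algebra_simps)
    moreover have "(1 - t) * a + t * a \<le> (1 - t) * fst p + t * fst q"
      using that ap aq by (intro add_mono mult_left_mono) auto
    ultimately show ?thesis by (simp add: algebra_simps)
  qed
  have "path_image \<gamma> \<subseteq> rot_space a"
    using unit Rge by (force simp: path_image_def rot_space_def \<gamma>_def)
  moreover have "rot_speed \<rho> \<gamma> integrable_on {0..1}"
  proof (rule integrable_continuous_real)
    have "rot_speed \<rho> \<gamma> = (\<lambda>t. sqrt ((fst (D t))\<^sup>2 + (\<rho> (R t))\<^sup>2 * (norm (snd (D t)))\<^sup>2))"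
      by (intro ext) (simp add: rot_speed_def Let_def vector_derivative_at[OF D], simp add: \<gamma>_def)
    moreover have "continuous_on {0..1} (\<lambda>t. \<rho> (R t))"
      by (rule continuous_on_compose2[OF \<rho>]) (use Rge in \<open>auto simp: R_def intro!: continuous_intros\<close>)
    moreover have "continuous_on {0..1} D" using cD continuous_on_subset by blast
    ultimately show "continuous_on {0..1} (rot_speed \<rho> \<gamma>)"
      by (auto intro!: continuous_intros)
  qed
  moreover have "\<gamma> 0 = p" "\<gamma> 1 = q"
    using e(3) by (auto simp: \<gamma>_def R_def prod_eq_iff)
  ultimately show ?thesis
    using vp by (auto simp: rot_curves_def pathstart_def pathfinish_def)
qed

lemma rot_dist_expansion:
  fixes p q :: "real \<times> (real ^ 'n)"
  assumes ne: "rot_curves a \<rho> p q \<noteq> {}"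
    and d: "\<And>s. s \<ge> a \<Longrightarrow> (f has_real_derivative f' s) (at s)"
    and f': "continuous_on {a..} f'"
    and le_f: "\<And>s. s \<ge> a \<Longrightarrow> b \<le> f s"
    and K: "\<And>s. s \<ge> a \<Longrightarrow> \<bar>f' s\<bar> \<le> K" and "K > 0"
    and \<sigma>: "\<And>s. s \<ge> a \<Longrightarrow> \<bar>\<sigma> (f s)\<bar> \<le> K * \<bar>\<rho> s\<bar>"
    and cont: "continuous_on {a..} (\<lambda>s. \<sigma> (f s))"
  shows "rot_dist b \<sigma> (apfst f p) (apfst f q) \<le> K * rot_dist a \<rho> p q"
proof -
  have "rot_dist b \<sigma> (apfst f p) (apfst f q) / K \<le> integral {0..1} (rot_speed \<rho> \<gamma>)"
    if \<gamma>: "\<gamma> \<in> rot_curves a \<rho> p q" for \<gamma>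
  proof -
    obtain \<gamma>' where "\<gamma>' \<in> rot_curves b \<sigma> (apfst f p) (apfst f q)"
      "integral {0..1} (rot_speed \<sigma> \<gamma>') \<le> K * integral {0..1} (rot_speed \<rho> \<gamma>)"
      using rot_curve_transport[OF \<gamma> d f' le_f K \<sigma> cont] by blast
    then have "rot_dist b \<sigma> (apfst f p) (apfst f q) \<le> K * integral {0..1} (rot_speed \<rho> \<gamma>)"
      using rot_dist_le_length by fastforce
    then show ?thesis using \<open>K > 0\<close> by (simp add: field_simps)
  qed
  then have "rot_dist b \<sigma> (apfst f p) (apfst f q) / K \<le> rot_dist a \<rho> p q"
    unfolding rot_dist_def[of a] by (intro cINF_greatest[OF ne]) auto
  then show ?thesis using \<open>K > 0\<close> by (simp add: field_simps)
qed

section \<open>Lipschitz distance and radial maps\<close>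

text \<open>The upper bound on the dilatation comes from all pairs of points. For the lower bound \<open>1 / K\<close> a single pair
  \<open>x\<close>, \<open>y\<close> suffices, since the dilatation is a supremum. A pair at distance \<open>0\<close> has quotient \<open>0\<close>.\<close>

lemma abs_ln_dil_le:
  assumes up: "\<And>x y. x \<in> X \<Longrightarrow> y \<in> X \<Longrightarrow> dY (\<phi> x) (\<phi> y) \<le> K * dX x y"
    and nonneg: "\<And>x y. x \<in> X \<Longrightarrow> y \<in> X \<Longrightarrow> 0 \<le> dX x y"
    and x: "x \<in> X" and y: "y \<in> X" and xy: "x \<noteq> y" and pos: "0 < dX x y"
    and low: "dX x y \<le> K * dY (\<phi> x) (\<phi> y)" and K: "K > 0"
  shows "\<bar>ln (dil X dX dY \<phi>)\<bar> \<le> ln K"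
proof -
  define Q where "Q = {dY (\<phi> x) (\<phi> y) / dX x y | x y. x \<in> X \<and> y \<in> X \<and> x \<noteq> y}"
  have Q_le: "c \<le> K" if c: "c \<in> Q" for c
  proof -
    obtain x' y' where *: "x' \<in> X" "y' \<in> X" "c = dY (\<phi> x') (\<phi> y') / dX x' y'"
      using c unfolding Q_def by blast
    show ?thesis
    proof (cases "dX x' y' = 0")
      case False
      with nonneg[of x' y'] * have "dX x' y' > 0" by simp
      then show ?thesis using up[of x' y'] * by (simp add: divide_le_eq)
    qed (use * K in simp)
  qed
  have "dY (\<phi> x) (\<phi> y) / dX x y \<in> Q" unfolding Q_def using x y xy by blast
  moreover have "1 / K \<le> dY (\<phi> x) (\<phi> y) / dX x y"
    using low pos K by (simp add: field_simps)
  moreover have "bdd_above Q" using Q_le by (rule bdd_aboveI)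
  ultimately have low': "1 / K \<le> dil X dX dY \<phi>" and up': "dil X dX dY \<phi> \<le> K"
    unfolding dil_def Q_def[symmetric]
    using Q_le cSup_upper2 cSup_least[of Q K] by (blast, blast)
  have "0 < dil X dX dY \<phi>" using low' K by (meson divide_pos_pos less_le_trans zero_less_one)
  moreover have "ln (1 / K) \<le> ln (dil X dX dY \<phi>)"
    using low' K by (intro ln_mono) auto
  moreover have "ln (dil X dX dY \<phi>) \<le> ln K"
    using up' calculation(1) by (intro ln_mono) auto
  ultimately show ?thesis using K by (simp add: ln_div abs_le_iff)
qed

lemma lipschitz_distance_le_of_bounds:
  assumes bij: "bij_betw \<phi> X Y" and K: "K > 0"
    and up: "\<And>x y. x \<in> X \<Longrightarrow> y \<in> X \<Longrightarrow> dY (\<phi> x) (\<phi> y) \<le> K * dX x y"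
    and low: "\<And>x y. x \<in> X \<Longrightarrow> y \<in> X \<Longrightarrow> dX x y \<le> K * dY (\<phi> x) (\<phi> y)"
    and nonneg: "\<And>x y. x \<in> X \<Longrightarrow> y \<in> X \<Longrightarrow> 0 \<le> dX x y"
    and x: "x \<in> X" and y: "y \<in> X" and xy: "x \<noteq> y" and pos: "0 < dX x y"
  shows "lipschitz_distance X dX Y dY \<le> ereal (2 * ln K)"
proof -
  define \<psi> where "\<psi> = the_inv_into X \<phi>"
  have \<psi>: "\<psi> u \<in> X" "\<phi> (\<psi> u) = u" if "u \<in> Y" for u
    using bij that unfolding \<psi>_def bij_betw_def
    by (auto intro: the_inv_into_into f_the_inv_into_f)
  have \<psi>\<phi>: "\<psi> (\<phi> u) = u" if "u \<in> X" for u
    using bij that unfolding \<psi>_def bij_betw_def by (auto intro: the_inv_into_f_f)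
  have \<phi>Y: "\<phi> u \<in> Y" if "u \<in> X" for u using bij that by (rule bij_betwE[rule_format])
  have posY: "0 < dY (\<phi> x) (\<phi> y)"
    using low[OF x y] pos K by (meson less_le_trans zero_less_mult_pos)
  have nonnegY: "0 \<le> dY u v" if "u \<in> Y" "v \<in> Y" for u v
  proof -
    have "0 \<le> K * dY u v"
      using low[of "\<psi> u" "\<psi> v"] nonneg[of "\<psi> u" "\<psi> v"] \<psi> that by simp
    then show ?thesis using K by (simp add: zero_le_mult_iff)
  qed
  have 1: "\<bar>ln (dil X dX dY \<phi>)\<bar> \<le> ln K"
    by (rule abs_ln_dil_le[where X = X and dX = dX and dY = dY and \<phi> = \<phi> and x = x and y = y,
          OF up nonneg x y xy pos low[OF x y] K])
  have 2: "\<bar>ln (dil Y dY dX \<psi>)\<bar> \<le> ln K"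
  proof (rule abs_ln_dil_le[where x = "\<phi> x" and y = "\<phi> y"])
    show "dX (\<psi> u) (\<psi> v) \<le> K * dY u v" if "u \<in> Y" "v \<in> Y" for u v
      using low[of "\<psi> u" "\<psi> v"] \<psi> that by simp
    show "\<phi> x \<noteq> \<phi> y" using \<psi>\<phi> x y xy by metis
  qed (use nonnegY \<phi>Y x y posY up \<psi>\<phi> K in auto)
  have "lipschitz_map X dX dY \<phi>"
    unfolding lipschitz_map_def using up by blast
  moreover have "dX (\<psi> u) (\<psi> v) \<le> K * dY u v" if "u \<in> Y" "v \<in> Y" for u v
    using low[OF \<psi>(1)[OF that(1)] \<psi>(1)[OF that(2)]] \<psi>(2) that by simp
  then have "lipschitz_map Y dY dX \<psi>"
    unfolding lipschitz_map_def by blast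
  ultimately have "\<phi> \<in> bilipschitz_maps X dX Y dY"
    using bij by (simp add: bilipschitz_maps_def \<psi>_def)
  then have "lipschitz_distance X dX Y dY
      \<le> ereal (\<bar>ln (dil X dX dY \<phi>)\<bar> + \<bar>ln (dil Y dY dX \<psi>)\<bar>)"
    unfolding lipschitz_distance_def \<psi>_def by (rule INF_lower)
  also have "\<dots> \<le> ereal (2 * ln K)" using 1 2 by simp
  finally show ?thesis .
qed

text \<open>Curves are transported both by \<open>f\<close> and by its inverse, whose derivative \<open>1 / f'\<close> obeys the same bounds.
  The lower bound on \<open>f'\<close> also forces \<open>f\<close> to be onto \<open>{f a..}\<close>.\<close>

lemma radial_map_lipschitz_distance:
  fixes \<rho> \<sigma> f f' :: "real \<Rightarrow> real"
  assumes n: "CARD('n::finite) \<ge> 2"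
    and d: "\<And>s. (f has_real_derivative f' s) (at s)" and f': "continuous_on {a..} f'"
    and pos: "\<And>s. f' s > 0"
    and K: "K > 0" "\<And>s. s \<ge> a \<Longrightarrow> f' s \<le> K" "\<And>s. s \<ge> a \<Longrightarrow> 1 \<le> K * f' s"
    and \<rho>: "\<And>s. s \<ge> a \<Longrightarrow> 0 < \<rho> s" and \<rho>_cont: "continuous_on {a..} \<rho>"
    and \<sigma>: "\<And>s. s \<ge> a \<Longrightarrow> \<sigma> (f s) \<le> K * \<rho> s" "\<And>s. s \<ge> a \<Longrightarrow> \<rho> s \<le> K * \<sigma> (f s)"
    and \<sigma>_cont: "continuous_on {a..} (\<lambda>s. \<sigma> (f s))"
  shows "lipschitz_distance
     (rot_space a :: (real \<times> (real ^ 'n)) set) (rot_dist a \<rho>)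
     (rot_space (f a) :: (real \<times> (real ^ 'n)) set) (rot_dist (f a) \<sigma>) \<le> ereal (2 * ln K)"
proof -
  have mono: "f x < f y" if "x < y" for x y
    using DERIV_pos_imp_increasing[OF that] d pos by blast
  have inj: "inj f" by (rule linorder_injI) (metis mono less_irrefl)
  define g where "g = the_inv f"
  have gf: "g (f s) = s" for s unfolding g_def by (rule the_inv_f_f[OF inj])
  have f_mono: "f x \<le> f y" if "x \<le> y" for x y using mono[of x y] that by (cases "x = y") auto
  have f_cont: "continuous_on UNIV f"
    using d by (meson DERIV_continuous continuous_at_imp_continuous_on)
  have surj: "\<exists>s\<ge>a. u = f s" if u: "u \<ge> f a" for u
  proof -
    (* Since f' is at least 1 / K, the value u is reached by the time s. *)
    define s where "s = a + K * (u - f a)"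
    have sa: "s \<ge> a" using u K by (simp add: s_def)
    have "f a - a / K \<le> f s - s / K"
    proof (rule DERIV_nonneg_imp_nondecreasing[OF sa])
      fix x assume "a \<le> x" "x \<le> s"
      then have "1 / K \<le> f' x" using K(3)[of x] K(1) by (simp add: divide_le_eq mult.commute)
      moreover have "((\<lambda>s. f s - s / K) has_real_derivative f' x - 1 / K) (at x)"
        by (rule DERIV_diff[OF d DERIV_cdivide[OF DERIV_ident]])
      ultimately show "\<exists>y. ((\<lambda>s. f s - s / K) has_real_derivative y) (at x) \<and> 0 \<le> y"
        by (intro exI[of _ "f' x - 1 / K"]) simp
    qed
    moreover have "s / K = a / K + (u - f a)" using K(1) by (simp add: s_def add_divide_distrib)
    ultimately have "u \<le> f s" by simp
    then obtain x where "a \<le> x" "x \<le> s" "f x = u"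
      using IVT'[of f a u s] u sa continuous_on_subset[OF f_cont] by auto
    then show ?thesis by blast
  qed
  have g: "g u \<ge> a" "f (g u) = u" if "u \<ge> f a" for u
    using surj[OF that] gf by auto
  have g_deriv: "(g has_real_derivative inverse (f' (g u))) (at u)" if u: "u \<ge> f a" for u
  proof -
    have "(g has_real_derivative inverse (f' (g u))) (at (f (g u)))"
      by (rule DERIV_left_inverse[OF open_UNIV UNIV_I f_cont gf d])
         (use pos[of "g u"] in auto)
    then show ?thesis using g u by simp
  qed
  have g_cont: "continuous_on {f a..} g"
    using g_deriv by (meson DERIV_continuous atLeast_iff continuous_at_imp_continuous_on)
  have g'_cont: "continuous_on {f a..} (\<lambda>u. inverse (f' (g u)))"
    by (intro continuous_intros continuous_on_compose2[OF f' g_cont])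
       (use g pos in \<open>auto simp: less_imp_neq[THEN not_sym]\<close>)
  have \<rho>g_cont: "continuous_on {f a..} (\<lambda>u. \<rho> (g u))"
    by (rule continuous_on_compose2[OF \<rho>_cont g_cont]) (use g in auto)
  have \<sigma>_pos: "0 < \<sigma> (f s)" if "s \<ge> a" for s
    using \<rho>[OF that] \<sigma>(2)[OF that] K(1) by (meson less_le_trans zero_less_mult_pos)
  define \<Phi> where "\<Phi> = (apfst f :: real \<times> (real ^ 'n) \<Rightarrow> _)"
  have ne: "rot_curves a \<rho> p q \<noteq> {}" if "p \<in> rot_space a" "q \<in> rot_space a"
    for p q :: "real \<times> (real ^ 'n)"
    using rot_curves_nonempty[OF n that \<rho>_cont] .
  have bij: "bij_betw \<Phi> (rot_space a) (rot_space (f a))"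
    by (rule bij_betwI[where g = "apfst g"])
       (auto simp: \<Phi>_def rot_space_def gf g f_mono)
  have up: "rot_dist (f a) \<sigma> (\<Phi> p) (\<Phi> q) \<le> K * rot_dist a \<rho> p q"
    if "p \<in> rot_space a" "q \<in> rot_space a" for p q
    unfolding \<Phi>_def
  proof (rule rot_dist_expansion[OF ne[OF that] d f'])
    show "\<bar>f' s\<bar> \<le> K" if "s \<ge> a" for s using K(2)[OF that] pos[of s] by simp
    show "\<bar>\<sigma> (f s)\<bar> \<le> K * \<bar>\<rho> s\<bar>" if "s \<ge> a" for s
      using \<sigma>(1)[OF that] \<rho>[OF that] \<sigma>_pos[OF that] by simp
  qed (use K f_mono \<sigma>_cont in auto)
  have low: "rot_dist a \<rho> p q \<le> K * rot_dist (f a) \<sigma> (\<Phi> p) (\<Phi> q)"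
    if pq: "p \<in> rot_space a" "q \<in> rot_space a" for p q
  proof -
    obtain \<gamma> where \<gamma>: "\<gamma> \<in> rot_curves a \<rho> p q" using ne[OF pq] by blast
    have "\<exists>\<gamma>'. \<gamma>' \<in> rot_curves (f a) \<sigma> (\<Phi> p) (\<Phi> q)"
      unfolding \<Phi>_def
      using rot_curve_transport[OF \<gamma> d f' f_mono _ _ \<sigma>_cont, where K = K]
        K(2) pos \<sigma>(1) \<rho> \<sigma>_pos by (force simp: abs_of_pos less_imp_le)
    then have "rot_curves (f a) \<sigma> (\<Phi> p) (\<Phi> q) \<noteq> {}" by blast
    then have "rot_dist a \<rho> (apfst g (\<Phi> p)) (apfst g (\<Phi> q)) \<le> K * rot_dist (f a) \<sigma> (\<Phi> p) (\<Phi> q)"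
    proof (rule rot_dist_expansion[OF _ g_deriv g'_cont g(1)])
      show "\<bar>inverse (f' (g u))\<bar> \<le> K" if "u \<ge> f a" for u
        using K(3)[OF g(1)[OF that]] pos[of "g u"] by (simp add: field_simps)
      show "\<bar>\<rho> (g u)\<bar> \<le> K * \<bar>\<sigma> u\<bar>" if u: "u \<ge> f a" for u
        using \<sigma>(2)[OF g(1)[OF u]] \<rho>[OF g(1)[OF u]] \<sigma>_pos[OF g(1)[OF u]] g(2)[OF u] by simp
    qed (use K \<rho>g_cont in auto)
    moreover have "apfst g (\<Phi> p) = p" "apfst g (\<Phi> q) = q"
      by (simp_all add: \<Phi>_def gf prod_eq_iff)
    ultimately show ?thesis by simp
  qed
  have dist_ge: "\<bar>fst q - fst p\<bar> \<le> rot_dist a \<rho> p q"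
    if "p \<in> rot_space a" "q \<in> rot_space a" for p q :: "real \<times> (real ^ 'n)"
    unfolding rot_dist_def
    by (rule cINF_greatest[OF ne[OF that]]) (rule radial_distance_le_length)
  define p q :: "real \<times> (real ^ 'n)" where "p = (a, axis undefined 1)" and "q = (a + 1, axis undefined 1)"
  have pq: "p \<in> rot_space a" "q \<in> rot_space a" "p \<noteq> q"
    by (auto simp: p_def q_def rot_space_def)
  show ?thesis
  proof (rule lipschitz_distance_le_of_bounds[where \<phi> = \<Phi> and dX = "rot_dist a \<rho>"
          and dY = "rot_dist (f a) \<sigma>" and x = p and y = q, OF bij K(1) up low _ pq])
    show "0 < rot_dist a \<rho> p q"
      using dist_ge[OF pq(1,2)] by (simp add: p_def q_def)
    show "0 \<le> rot_dist a \<rho> u v" if "u \<in> rot_space a" "v \<in> rot_space a"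
      for u v :: "real \<times> (real ^ 'n)"
      using dist_ge[OF that] by (meson abs_ge_zero order_trans)
  qed
qed

section \<open>Appended Schwarzschild space\<close>

text \<open>The derivative of the area radius with respect to the distance to the horizon, as a function of the
  area radius.\<close>

definition sch_slope :: "nat \<Rightarrow> real \<Rightarrow> real \<Rightarrow> real" where
  "sch_slope n m x = sqrt (1 - 2 * m / x ^ (n - 2))"

lemma sch_radius_power:
  assumes "n \<ge> 3" "m > 0"
  shows "sch_radius n m > 0" "sch_radius n m ^ (n - 2) = 2 * m"
proof -
  show "sch_radius n m > 0" using assms by (simp add: sch_radius_def)
  then have "sch_radius n m ^ (n - 2) = sch_radius n m powr (real n - 2)"
    using assms by (simp add: powr_realpow[symmetric] of_nat_diff)
  also have "\<dots> = 2 * m"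
    unfolding sch_radius_def powr_powr using assms by simp
  finally show "sch_radius n m ^ (n - 2) = 2 * m" .
qed

text \<open>With \<open>R\<close> the horizon radius, \<open>2 m = R ^ (n - 2)\<close>, and \<open>(R / x) ^ (n - 2) \<le> R / x\<close> reduces the
  singularity of the arc length density in any dimension to that of \<open>sqrt (x / (x - R))\<close>.\<close>

lemma sch_slope_bounds:
  assumes n: "n \<ge> 3" and m: "m > 0" and x: "x > sch_radius n m"
  shows "2 * m < x ^ (n - 2)" "0 < sch_slope n m x" "sch_slope n m x < 1"
    "1 / sch_slope n m x \<le> sqrt (x / (x - sch_radius n m))"
    "(sch_slope n m x)\<^sup>2 = 1 - 2 * m / x ^ (n - 2)"
proof -
  define R where "R = sch_radius n m"
  have R: "R > 0" "R ^ (n - 2) = 2 * m" using sch_radius_power[OF n m] by (auto simp: R_def)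
  have xR: "x > R" using x by (simp add: R_def)
  show lt: "2 * m < x ^ (n - 2)"
    using power_strict_mono[OF xR, of "n - 2"] R n by simp
  have pos: "0 < x ^ (n - 2)" using lt m by simp
  show "0 < sch_slope n m x" using lt pos by (simp add: sch_slope_def)
  show "sch_slope n m x < 1" using pos m by (simp add: sch_slope_def)
  show "(sch_slope n m x)\<^sup>2 = 1 - 2 * m / x ^ (n - 2)"
    using lt pos by (simp add: sch_slope_def)
  have "(R / x) ^ (n - 2) \<le> (R / x) ^ 1"
    using R xR n by (intro power_decreasing) auto
  then have "(x - R) / x \<le> 1 - 2 * m / x ^ (n - 2)"
    using R xR by (simp add: power_divide diff_divide_distrib)
  then have "sqrt ((x - R) / x) \<le> sch_slope n m x"
    unfolding sch_slope_def by (rule real_sqrt_le_mono)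
  moreover have "0 < sqrt ((x - R) / x)" using R xR by simp
  ultimately have "1 / sch_slope n m x \<le> 1 / sqrt ((x - R) / x)"
    by (intro divide_left_mono mult_pos_pos) linarith+
  then show "1 / sch_slope n m x \<le> sqrt (x / (x - sch_radius n m))"
    by (simp add: real_sqrt_divide R_def)
qed

lemma sch_slope_mono:
  assumes n: "n \<ge> 3" and m: "m > 0" and x: "sch_radius n m < x" and y: "x \<le> y"
  shows "sch_slope n m x \<le> sch_slope n m y"
proof -
  have x0: "x > 0" using sch_radius_power(1)[OF n m] x by simp
  have "2 * m / y ^ (n - 2) \<le> 2 * m / x ^ (n - 2)"
    using x0 y m by (intro divide_left_mono power_mono) auto
  then show ?thesis by (simp add: sch_slope_def)
qed

lemma sch_slope_continuous: "continuous_on {0<..} (sch_slope n m)"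
  unfolding sch_slope_def by (intro continuous_intros) auto

lemma
  assumes n: "n \<ge> 3" and m: "m > 0"
  shows sch_arclength_deriv: "x > sch_radius n m \<Longrightarrow>
      (sch_arclength n m has_real_derivative 1 / sch_slope n m x) (at x)"
    and sch_arclength_continuous: "continuous_on {sch_radius n m..} (sch_arclength n m)"
    and sch_height_deriv: "x > sch_radius n m \<Longrightarrow>
      (sch_height n m has_real_derivative sqrt (1 - (sch_slope n m x)\<^sup>2) / sch_slope n m x) (at x)"
    and sch_height_continuous: "continuous_on {sch_radius n m..} (sch_height n m)"
proof -
  define R where "R = sch_radius n m"
  define h where "h = (\<lambda>t. sqrt (2 * m / (t ^ (n - 2) - 2 * m)))"
  have R: "R > 0" using sch_radius_power[OF n m] by (auto simp: R_def)
  have bounds: "2 * m < x ^ (n - 2)" "0 < sch_slope n m x" "sch_slope n m x < 1"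
    "1 / sch_slope n m x \<le> sqrt (x / (x - R))" "(sch_slope n m x)\<^sup>2 = 1 - 2 * m / x ^ (n - 2)"
    if "x > R" for x
    using sch_slope_bounds[OF n m that[unfolded R_def]] by (auto simp: R_def)
  have A: "sch_arclength n m = (\<lambda>x. integral {R..x} (\<lambda>t. 1 / sch_slope n m t))"
    by (simp add: sch_arclength_def[abs_def] sch_slope_def R_def)
  have H: "sch_height n m = (\<lambda>x. integral {R..x} h)"
    by (simp add: sch_height_def[abs_def] h_def R_def)
  have cA: "continuous_on {R<..} (\<lambda>t. 1 / sch_slope n m t)"
    using bounds R by (intro continuous_intros continuous_on_subset[OF sch_slope_continuous])
      (auto simp: less_imp_neq[THEN not_sym])
  have bA: "\<bar>1 / sch_slope n m t\<bar> \<le> sqrt (t / (t - R))" if "t > R" for t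
    using bounds[OF that] by simp
  have h_eq: "h t = sqrt (1 - (sch_slope n m t)\<^sup>2) / sch_slope n m t" if "t > R" for t
  proof -
    have "t ^ (n - 2) > 0" using R that by simp
    then have "2 * m / (t ^ (n - 2) - 2 * m) = (1 - (sch_slope n m t)\<^sup>2) / (sch_slope n m t)\<^sup>2"
      unfolding bounds(5)[OF that] using bounds(1)[OF that] R that
      by (simp add: field_simps less_imp_neq[THEN not_sym])
    then have "h t = sqrt ((1 - (sch_slope n m t)\<^sup>2) / (sch_slope n m t)\<^sup>2)"
      unfolding h_def by (rule arg_cong)
    then show ?thesis
      using bounds(2)[OF that] by (simp add: real_sqrt_divide)
  qed
  have cH: "continuous_on {R<..} h"
    unfolding h_def using bounds(1)
    by (intro continuous_intros) (auto simp: less_imp_neq[THEN not_sym])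
  have bH: "\<bar>h t\<bar> \<le> sqrt (t / (t - R))" if "t > R" for t
  proof -
    have "sqrt (1 - (sch_slope n m t)\<^sup>2) / sch_slope n m t \<le> 1 / sch_slope n m t"
      using bounds(2)[OF that] by (intro divide_right_mono) auto
    moreover have "(sch_slope n m t)\<^sup>2 \<le> 1"
      using bounds(2,3)[OF that] by (simp add: power_le_one)
    ultimately show ?thesis
      using bounds[OF that] by (simp add: h_eq[OF that])
  qed
  note R0 = less_imp_le[OF R]
  show "(sch_arclength n m has_real_derivative 1 / sch_slope n m x) (at x)"
    if "x > sch_radius n m"
    unfolding A by (rule endpoint_singular_deriv[OF R0 cA bA]) (use that R_def in auto)
  show "continuous_on {sch_radius n m..} (sch_arclength n m)"
    unfolding A using endpoint_singular_continuous[OF R0 cA bA] by (simp add: R_def)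
  show "(sch_height n m has_real_derivative sqrt (1 - (sch_slope n m x)\<^sup>2) / sch_slope n m x) (at x)"
    if "x > sch_radius n m"
    using endpoint_singular_deriv[OF R0 cH bH, of x] h_eq[of x] that
    unfolding H by (simp add: R_def)
  show "continuous_on {sch_radius n m..} (sch_height n m)"
    unfolding H using endpoint_singular_continuous[OF R0 cH bH] by (simp add: R_def)
qed

lemma sch_arclength_horizon [simp]: "sch_arclength n m (sch_radius n m) = 0"
  and sch_height_horizon [simp]: "sch_height n m (sch_radius n m) = 0"
  by (simp_all add: sch_arclength_def sch_height_def)

text \<open>The density of arc length is at least \<open>1\<close>. Hence arc length is injective and onto \<open>{0..}\<close>, and its
  inverse, the profile, does not increase distances.\<close>

lemma sch_arclength_expanding:
  assumes n: "n \<ge> 3" and m: "m > 0" and x: "sch_radius n m \<le> x" and y: "x \<le> y"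
  shows "y - x \<le> sch_arclength n m y - sch_arclength n m x"
proof -
  have "sch_arclength n m x - x \<le> sch_arclength n m y - y"
  proof (rule DERIV_nonneg_imp_increasing_open[OF y])
    fix t assume t: "x < t" "t < y"
    then have "t > sch_radius n m" using x by simp
    note d = sch_arclength_deriv[OF n m this] and b = sch_slope_bounds[OF n m this]
    show "\<exists>D. ((\<lambda>t. sch_arclength n m t - t) has_real_derivative D) (at t) \<and> 0 \<le> D"
      using DERIV_diff[OF d DERIV_ident] b(2,3)
      by (intro exI[of _ "1 / sch_slope n m t - 1"]) (simp add: field_simps)
  next
    show "continuous_on {x..y} (\<lambda>t. sch_arclength n m t - t)"
      using x by (intro continuous_intros
          continuous_on_subset[OF sch_arclength_continuous[OF n m]]) auto
  qed
  then show ?thesis by simp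
qed

lemma sch_profile_arclength:
  assumes n: "n \<ge> 3" and m: "m > 0" and x: "sch_radius n m \<le> x"
  shows "sch_profile n m (sch_arclength n m x) = x"
  unfolding sch_profile_def
proof (rule the_inv_into_f_f)
  show "inj_on (sch_arclength n m) {sch_radius n m..}"
  proof (rule linorder_inj_onI)
    fix x y assume "x < y" "x \<in> {sch_radius n m..}" "y \<in> {sch_radius n m..}"
    then show "sch_arclength n m x \<noteq> sch_arclength n m y"
      using sch_arclength_expanding[OF n m, of x y] by simp
  qed auto
qed (use x in auto)

lemma sch_arclength_surj:
  assumes n: "n \<ge> 3" and m: "m > 0" and u: "0 \<le> u"
  obtains x where "sch_radius n m \<le> x" "sch_arclength n m x = u"
proof -
  have "u \<le> sch_arclength n m (sch_radius n m + u)"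
    using sch_arclength_expanding[OF n m order_refl, of "sch_radius n m + u"] u by simp
  then show ?thesis
    using IVT'[of "sch_arclength n m" "sch_radius n m" u "sch_radius n m + u"] u that
      continuous_on_subset[OF sch_arclength_continuous[OF n m], of "{sch_radius n m..sch_radius n m + u}"]
    by auto
qed

lemma appended_sch_profile_continuous:
  assumes n: "n \<ge> 3" and m: "m > 0"
  shows "continuous_on UNIV (appended_sch_profile n m)"
proof -
  have nonexpanding: "\<bar>sch_profile n m u - sch_profile n m v\<bar> \<le> \<bar>u - v\<bar>" if uv: "0 \<le> u" "0 \<le> v" for u v
  proof -
    obtain x y where "sch_radius n m \<le> x" "sch_arclength n m x = u"
      "sch_radius n m \<le> y" "sch_arclength n m y = v"
      using sch_arclength_surj[OF n m] uv by metis
    then show ?thesis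
      using sch_arclength_expanding[OF n m, of x y] sch_arclength_expanding[OF n m, of y x]
        sch_profile_arclength[OF n m, of x] sch_profile_arclength[OF n m, of y]
      by (cases "x \<le> y") auto
  qed
  have "continuous_on {0..} (sch_profile n m)"
    by (rule continuous_onI) (metis atLeast_iff dist_real_def nonexpanding order.strict_trans1 less_imp_le order_trans)
  moreover have "sch_profile n m 0 = sch_radius n m"
    using sch_profile_arclength[OF n m order_refl] by simp
  ultimately have "continuous_on ({..0} \<union> {0..}) (appended_sch_profile n m)"
    unfolding appended_sch_profile_def
    by (intro continuous_on_If) auto
  moreover have "{..0} \<union> {0..} = (UNIV :: real set)" by auto
  ultimately show ?thesis by simp
qed

lemma appended_sch_profile_bounds:
  assumes n: "n \<ge> 3" and m: "m > 0" and x: "sch_radius n m \<le> x" and u: "u \<le> sch_arclength n m x"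
  shows "sch_radius n m \<le> appended_sch_profile n m u" "appended_sch_profile n m u \<le> x"
proof -
  have "sch_radius n m \<le> appended_sch_profile n m u \<and> appended_sch_profile n m u \<le> x"
  proof (cases "u \<le> 0")
    case False
    then obtain y where y: "sch_radius n m \<le> y" "sch_arclength n m y = u"
      using sch_arclength_surj[OF n m, of u] by (metis linear)
    then have "y \<le> x" using sch_arclength_expanding[OF n m x, of y] u by linarith
    then show ?thesis
      using y False sch_profile_arclength[OF n m y(1)] by (simp add: appended_sch_profile_def)
  qed (use x in \<open>simp add: appended_sch_profile_def\<close>)
  then show "sch_radius n m \<le> appended_sch_profile n m u" "appended_sch_profile n m u \<le> x" by auto
qed

lemma appended_sch_profile_arclength:
  assumes n: "n \<ge> 3" and m: "m > 0" and x: "sch_radius n m \<le> x"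
  shows "appended_sch_profile n m (sch_arclength n m x) = x"
  using sch_profile_arclength[OF n m x] sch_arclength_expanding[OF n m order_refl x] x
  by (auto simp: appended_sch_profile_def)

section \<open>Profiles and Hawking mass\<close>

lemma hderiv_works:
  assumes "f differentiable (at s within {0..})" "s \<ge> 0"
  shows "(f has_real_derivative hderiv f s) (at s within {0..})"
  using assms unfolding hderiv_def
  by (metis has_real_derivative_iff_has_vector_derivative vector_derivative_works)

lemma hderiv_interior:
  assumes "f differentiable (at s within {0..})" "s > 0"
  shows "(f has_real_derivative hderiv f s) (at s)"
proof -
  have "at s within {0..} = at s"
    using assms(2) by (intro at_within_interior) (simp add: interior_Ici[where b = "-1"])
  then show ?thesis using hderiv_works[OF assms(1)] assms(2) by simp
qed

lemma
  assumes r: "RotSym n r"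
  shows RotSym_deriv: "s > 0 \<Longrightarrow> (r has_real_derivative hderiv r s) (at s)"
    and RotSym_deriv2: "s > 0 \<Longrightarrow> (hderiv r has_real_derivative hderiv (hderiv r) s) (at s)"
    and RotSym_continuous: "continuous_on {0..} r"
    and RotSym_deriv_continuous: "continuous_on {0..} (hderiv r)"
proof -
  have smooth: "(hderiv ^^ k) r differentiable (at s within {0..})" if "s \<ge> 0" for k s
    using r that by (auto simp: RotSym_def smooth_halfline_def)
  have d0: "r differentiable (at s within {0..})"
    and d1: "hderiv r differentiable (at s within {0..})" if "s \<ge> 0" for s
    using smooth[of s 0] smooth[of s 1] that by auto
  show "s > 0 \<Longrightarrow> (r has_real_derivative hderiv r s) (at s)"
    "s > 0 \<Longrightarrow> (hderiv r has_real_derivative hderiv (hderiv r) s) (at s)"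
    using d0[of s] d1[of s] by (auto intro: hderiv_interior)
  show "continuous_on {0..} r" "continuous_on {0..} (hderiv r)"
    using d0 d1 by (auto simp: continuous_on_eq_continuous_within
        intro: differentiable_imp_continuous_within)
qed

lemma RotSym_strict_mono:
  assumes r: "RotSym n r" and "0 \<le> s" "s < t"
  shows "r s < r t"
proof (rule DERIV_pos_imp_increasing_open[OF \<open>s < t\<close>])
  show "\<exists>y. (r has_real_derivative y) (at x) \<and> 0 < y" if "s < x" "x < t" for x
    using RotSym_deriv[OF r, of x] r that \<open>0 \<le> s\<close> by (auto simp: RotSym_def)
  show "continuous_on {s..t} r"
    by (rule continuous_on_subset[OF RotSym_continuous[OF r]]) (use assms in auto)
qed

lemma RotSym_mono:
  assumes "RotSym n r" "0 \<le> s" "s \<le> t"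
  shows "r s \<le> r t"
  using RotSym_strict_mono[OF assms(1,2), of t] assms(3) by (cases "s = t") auto

lemma RotSym_inj_on:
  assumes "RotSym n r"
  shows "inj_on r {0..}"
proof (rule linorder_inj_onI)
  fix x y :: real assume "x < y" "x \<in> {0..}"
  then show "r x \<noteq> r y"
    using RotSym_strict_mono[OF assms, of x y] by simp
qed auto

text \<open>The derivative of the Hawking mass is \<open>r ^ (n - 3) r' / 2\<close> times the bracket in the scalar curvature.\<close>

lemma hawking_mass_mono:
  assumes n: "n \<ge> 3" and r: "RotSym n r" and st: "0 \<le> s" "s \<le> t"
  shows "hawking_mass n r s \<le> hawking_mass n r t"
proof (rule DERIV_nonneg_imp_increasing_open[OF st(2)])
  show "continuous_on {s..t} (hawking_mass n r)"
    unfolding hawking_mass_def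
    by (intro continuous_intros continuous_on_subset[OF RotSym_continuous[OF r]]
        continuous_on_subset[OF RotSym_deriv_continuous[OF r]]) (use st in auto)
  fix x assume x: "s < x" "x < t"
  then have x0: "x > 0" using st by simp
  define \<rho> p q where "\<rho> = r x" and "p = hderiv r x" and "q = hderiv (hderiv r) x"
  have pos: "\<rho> > 0" "p > 0" using r x0 by (auto simp: RotSym_def \<rho>_def p_def)
  obtain k where k: "n = k + 3" using n by (metis add.commute le_Suc_ex)
  have "0 \<le> (real n - 1) / \<rho>\<^sup>2 * ((real n - 2) * (1 - p\<^sup>2) - 2 * \<rho> * q)"
    using r x0 by (auto simp: RotSym_def scalar_curvature_def \<rho>_def p_def q_def)
  moreover have "(real n - 1) / \<rho>\<^sup>2 > 0" using n pos by simp
  ultimately have curv: "0 \<le> (real n - 2) * (1 - p\<^sup>2) - 2 * \<rho> * q"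
    by (metis mult_le_cancel_left_pos mult_zero_right)
  have "(hawking_mass n r has_real_derivative
      (real k + 1) * \<rho> ^ k * p / 2 * (1 - p\<^sup>2) + \<rho> ^ (k + 1) / 2 * (- (2 * p * q))) (at x)"
    unfolding hawking_mass_def[abs_def] k
    by (auto intro!: derivative_eq_intros RotSym_deriv[OF r x0] RotSym_deriv2[OF r x0]
        simp: \<rho>_def p_def q_def) (cases k; simp add: algebra_simps)
  moreover have "(real k + 1) * \<rho> ^ k * p / 2 * (1 - p\<^sup>2) + \<rho> ^ (k + 1) / 2 * (- (2 * p * q))
      = \<rho> ^ k * p / 2 * ((real n - 2) * (1 - p\<^sup>2) - 2 * \<rho> * q)"
    by (simp add: k field_simps)
  moreover have "0 \<le> \<rho> ^ k * p / 2 * ((real n - 2) * (1 - p\<^sup>2) - 2 * \<rho> * q)"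
    using curv pos by (intro mult_nonneg_nonneg) auto
  ultimately show "\<exists>y. (hawking_mass n r has_real_derivative y) (at x) \<and> 0 \<le> y"
    by metis
qed

text \<open>The limit exists, and is the supremum, by monotonicity.\<close>

lemma hawking_mass_le_ADM:
  assumes n: "n \<ge> 3" and r: "RotSym n r" and s: "0 \<le> s"
  shows "ereal (hawking_mass n r s) \<le> ADM_mass n r"
proof -
  define l where "l = (SUP t\<in>{0..}. ereal (hawking_mass n r t))"
  have le_l: "ereal (hawking_mass n r t) \<le> l" if "t \<ge> 0" for t
    unfolding l_def using that by (intro SUP_upper) auto
  have "((\<lambda>t. ereal (hawking_mass n r t)) \<longlongrightarrow> l) at_top"
  proof (rule order_tendstoI)
    fix a assume "a < l"
    then obtain t where t: "t \<ge> 0" "a < ereal (hawking_mass n r t)"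
      unfolding l_def less_SUP_iff by auto
    show "\<forall>\<^sub>F u in at_top. a < ereal (hawking_mass n r u)"
      using eventually_ge_at_top[of t]
    proof eventually_elim
      case (elim u)
      then show ?case using t hawking_mass_mono[OF n r t(1) elim]
        by (meson ereal_less_eq(3) less_le_trans)
    qed
  next
    fix a assume "l < a"
    show "\<forall>\<^sub>F u in at_top. ereal (hawking_mass n r u) < a"
      using eventually_ge_at_top[of "0::real"]
      by eventually_elim (use le_l \<open>l < a\<close> le_less_trans in blast)
  qed
  then have "ADM_mass n r = l"
    unfolding ADM_mass_def by (intro tendsto_Lim) auto
  then show ?thesis using le_l[OF s] by simp
qed

text \<open>As \<open>r' 0 = 0\<close>, the boundary mass is the Hawking mass of the boundary, and \<open>r 0\<close> is the horizon radius
  of the Schwarzschild space of that mass.\<close>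

lemma
  assumes n: "n \<ge> 3" and r: "RotSym n r"
  shows boundary_mass_eq: "boundary_mass n r = r 0 ^ (n - 2) / 2"
    and boundary_mass_pos: "boundary_mass n r > 0"
    and boundary_mass_eq_hawking: "boundary_mass n r = hawking_mass n r 0"
    and sch_radius_boundary_mass: "sch_radius n (boundary_mass n r) = r 0"
proof -
  have r0: "r 0 > 0" and h0: "hderiv r 0 = 0" using r by (auto simp: RotSym_def)
  have "unit_sphere_area n > 0"
    using n by (simp add: unit_sphere_area_def unit_ball_vol_pos)
  then have "boundary_area n r / unit_sphere_area n = r 0 powr (real n - 1)"
    using r0 n by (simp add: boundary_area_def powr_realpow[symmetric] of_nat_diff)
  then have "boundary_mass n r = r 0 powr (real n - 2) / 2"
    using n by (simp add: boundary_mass_def powr_powr)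
  then show eq: "boundary_mass n r = r 0 ^ (n - 2) / 2"
    using r0 n by (simp add: powr_realpow[symmetric] of_nat_diff)
  show "boundary_mass n r > 0" "boundary_mass n r = hawking_mass n r 0"
    using r0 h0 by (simp_all add: eq hawking_mass_def)
  have "sch_radius n (boundary_mass n r) = (r 0 powr (real n - 2)) powr (1 / (real n - 2))"
    using r0 n by (simp add: sch_radius_def eq powr_realpow[symmetric] of_nat_diff)
  then show "sch_radius n (boundary_mass n r) = r 0"
    using r0 n by (simp add: powr_powr)
qed

lemma hderiv_square_eq:
  assumes "RotSym n r" "s \<ge> 0"
  shows "(hderiv r s)\<^sup>2 = 1 - 2 * hawking_mass n r s / r s ^ (n - 2)"
proof -
  have "r s > 0" using assms by (simp add: RotSym_def)
  then show ?thesis by (simp add: hawking_mass_def)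
qed

lemma hderiv_nonneg: "RotSym n r \<Longrightarrow> s \<ge> 0 \<Longrightarrow> hderiv r s \<ge> 0"
  by (cases "s = 0") (auto simp: RotSym_def less_imp_le)

text \<open>The Hawking mass is at least its value at the boundary.\<close>

lemma hderiv_le_sch_slope:
  assumes n: "n \<ge> 3" and r: "RotSym n r" and s: "s \<ge> 0"
  shows "hderiv r s \<le> sch_slope n (boundary_mass n r) (r s)"
proof -
  have "boundary_mass n r \<le> hawking_mass n r s"
    using hawking_mass_mono[OF n r order_refl s] boundary_mass_eq_hawking[OF n r] by simp
  moreover have "r s ^ (n - 2) > 0" using r s by (simp add: RotSym_def)
  ultimately have "(hderiv r s)\<^sup>2 \<le> 1 - 2 * boundary_mass n r / r s ^ (n - 2)"
    unfolding hderiv_square_eq[OF r s] by (simp add: divide_right_mono)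
  then show ?thesis unfolding sch_slope_def by (rule real_le_rsqrt)
qed

lemma hderiv_less_1:
  assumes n: "n \<ge> 3" and r: "RotSym n r" and s: "s \<ge> 0"
  shows "hderiv r s < 1"
proof -
  have "r s ^ (n - 2) > 0" using r s by (simp add: RotSym_def)
  then have "sch_slope n (boundary_mass n r) (r s) < 1"
    using boundary_mass_pos[OF n r] by (simp add: sch_slope_def)
  then show ?thesis using hderiv_le_sch_slope[OF n r s] by simp
qed

text \<open>The bound on the ADM mass makes it finite, so that the mass excess is computed from its true value.\<close>

lemma
  assumes n: "n \<ge> 3" and r: "RotSym n r" 
    and fin: "ADM_mass n r \<le> ereal ((1 + d) * boundary_mass n r)"
  shows mass_excess_nonneg: "0 \<le> mass_excess n r"
    and mass_excess_le: "mass_excess n r \<le> d"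
    and hawking_mass_le_excess:
      "s \<ge> 0 \<Longrightarrow> hawking_mass n r s \<le> (1 + mass_excess n r) * boundary_mass n r"
proof -
  define m where "m = boundary_mass n r"
  have m: "m > 0" using boundary_mass_pos[OF n r] by (simp add: m_def)
  have ge: "ereal (hawking_mass n r s) \<le> ADM_mass n r" if "s \<ge> 0" for s
    using hawking_mass_le_ADM[OF n r that] .
  obtain a where a: "ADM_mass n r = ereal a"
    using fin ge[of 0] by (cases "ADM_mass n r") auto
  have ex: "mass_excess n r = a / m - 1" by (simp add: mass_excess_def a m_def)
  have "m \<le> a" using ge[of 0] boundary_mass_eq_hawking[OF n r] by (simp add: a m_def)
  then show "0 \<le> mass_excess n r" using m by (simp add: ex)
  have "a \<le> (1 + d) * m" using fin by (simp add: a m_def)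
  then show "mass_excess n r \<le> d" using m by (simp add: ex field_simps)
  show "s \<ge> 0 \<Longrightarrow> hawking_mass n r s \<le> (1 + mass_excess n r) * boundary_mass n r"
    using ge[of s] m unfolding m_def[symmetric] by (simp add: ex a)
qed

lemma matching_radius_power:
  assumes n: "n \<ge> 3" and r: "RotSym n r" and nonneg: "0 \<le> mass_excess n r"
  shows "matching_radius n r ^ (n - 2) = (1 + sqrt (mass_excess n r)) * (2 * boundary_mass n r)"
proof -
  define u where "u = 1 + sqrt (mass_excess n r)"
  have u: "u > 0" using nonneg by (simp add: u_def add_pos_nonneg)
  have "(u powr (1 / (real n - 2))) ^ (n - 2) = (u powr (1 / (real n - 2))) powr (real n - 2)"
    using u n by (simp add: powr_realpow[symmetric] of_nat_diff)
  also have "\<dots> = u" using u n by (simp add: powr_powr)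
  finally show ?thesis
    by (simp add: matching_radius_def u_def[symmetric] power_mult_distrib boundary_mass_eq[OF n r])
qed

lemma matching_radius_bounds:
  assumes n: "n \<ge> 3" and r: "RotSym n r" and nonneg: "0 \<le> mass_excess n r"
  shows "r 0 \<le> matching_radius n r" "matching_radius n r \<le> (1 + sqrt (mass_excess n r)) * r 0"
    "0 < mass_excess n r \<Longrightarrow> r 0 < matching_radius n r"
proof -
  define u where "u = 1 + sqrt (mass_excess n r)"
  define e where "e = 1 / (real n - 2)"
  have u: "u \<ge> 1" using nonneg by (simp add: u_def)
  have e: "0 < e" "e \<le> 1" using n by (auto simp: e_def)
  have r0: "r 0 > 0" using r by (simp add: RotSym_def)
  have eq: "matching_radius n r = u powr e * r 0" by (simp add: matching_radius_def u_def e_def)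
  show "r 0 \<le> matching_radius n r"
    unfolding eq using ge_one_powr_ge_zero[OF u, of e] e r0 by simp
  have "u powr e \<le> u" using powr_mono[OF e(2) u] u by simp
  then show "matching_radius n r \<le> (1 + sqrt (mass_excess n r)) * r 0"
    unfolding eq u_def[symmetric] using r0 by simp
  show "r 0 < matching_radius n r" if "0 < mass_excess n r"
  proof -
    have "u > 1" using that by (simp add: u_def)
    then have "u powr e > 1" using e by simp
    then show ?thesis unfolding eq using r0 by simp
  qed
qed

text \<open>Let \<open>\<delta>\<close> be the square root of the mass excess and \<open>v = r ^ (n - 2)\<close>. As the Hawking mass is at most
  \<open>(1 + \<delta>\<^sup>2) m\<close>, it suffices that \<open>(1 - \<delta>) (v - 2 m) \<le> v - 2 (1 + \<delta>\<^sup>2) m\<close>. After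
  cancelling \<open>\<delta>\<close> this reads \<open>2 m \<delta> \<le> v - 2 m\<close>, which is how the matching radius was chosen. It gives
  \<open>(1 - \<delta>) \<sigma>\<^sup>2 \<le> r'\<^sup>2\<close>, and \<open>(1 - \<delta>)\<^sup>2 \<le> 1 - \<delta>\<close> turns this into a bound without square roots.\<close>

lemma hderiv_ge_sch_slope:
  assumes n: "n \<ge> 3" and r: "RotSym n r"
    and fin: "ADM_mass n r \<le> ereal ((1 + d) * boundary_mass n r)" and "mass_excess n r < 1"
    and s: "s \<ge> 0" and out: "matching_radius n r \<le> r s"
  shows "(1 - sqrt (mass_excess n r)) * sch_slope n (boundary_mass n r) (r s) \<le> hderiv r s"
proof -
  define m \<delta> where "m = boundary_mass n r" and "\<delta> = sqrt (mass_excess n r)"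
  define v where "v = r s ^ (n - 2)"
  have m: "m > 0" using boundary_mass_pos[OF n r] by (simp add: m_def)
  have ex: "0 \<le> mass_excess n r" by (rule mass_excess_nonneg[OF n r fin])
  have \<delta>: "0 \<le> \<delta>" "\<delta> < 1" "\<delta>\<^sup>2 = mass_excess n r" using ex assms(4) by (auto simp: \<delta>_def)
  have "0 \<le> matching_radius n r"
    using matching_radius_bounds(1)[OF n r ex] r by (force simp: RotSym_def)
  then have v: "(1 + \<delta>) * (2 * m) \<le> v"
    using power_mono[OF out, of "n - 2"] matching_radius_power[OF n r ex]
    by (simp add: v_def \<delta>_def m_def)
  then have v0: "v > 0" using m \<delta> by (smt (verit) mult_pos_pos)
  have "2 * m * \<delta>\<^sup>2 \<le> \<delta> * (v - 2 * m)"
    using mult_left_mono[OF v \<delta>(1)] by (simp add: algebra_simps power2_eq_square)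
  then have "(1 - \<delta>) * (v - 2 * m) \<le> v - 2 * ((1 + \<delta>\<^sup>2) * m)"
    by (simp add: algebra_simps)
  then have "(1 - \<delta>) * (v - 2 * m) / v \<le> (v - 2 * ((1 + \<delta>\<^sup>2) * m)) / v"
    using v0 by (intro divide_right_mono) auto
  then have "(1 - \<delta>) * (1 - 2 * m / v) \<le> 1 - 2 * ((1 + \<delta>\<^sup>2) * m) / v"
    using v0 by (simp add: diff_divide_distrib flip: times_divide_eq_right)
  also have "\<dots> \<le> (hderiv r s)\<^sup>2"
    unfolding hderiv_square_eq[OF r s] v_def[symmetric]
    using hawking_mass_le_excess[OF n r fin s] v0 by (simp add: \<delta>(3) m_def divide_right_mono)
  finally have *: "(1 - \<delta>) * (1 - 2 * m / v) \<le> (hderiv r s)\<^sup>2" .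
  have "2 * m \<le> v" using v \<delta> m by (smt (verit) mult_le_cancel_right1)
  then have sq: "0 \<le> 1 - 2 * m / v" using v0 by simp
  then have "((1 - \<delta>) * sch_slope n m (r s))\<^sup>2 = (1 - \<delta>)\<^sup>2 * (1 - 2 * m / v)"
    by (simp add: power_mult_distrib sch_slope_def v_def)
  also have "\<dots> \<le> (1 - \<delta>) * (1 - 2 * m / v)"
    using \<delta> sq by (intro mult_right_mono) (auto simp: power2_eq_square mult_left_le)
  finally have "((1 - \<delta>) * sch_slope n m (r s))\<^sup>2 \<le> (hderiv r s)\<^sup>2" using * by simp
  then show ?thesis
    unfolding \<delta>_def[symmetric] m_def[symmetric] using hderiv_nonneg[OF r s] by (rule power2_le_imp_le)
qed

text \<open>The squared slope at the matching radius is \<open>\<delta> / (1 + \<delta>)\<close> with \<open>\<delta>\<close> the square root of the mass excess.\<close>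

lemma sch_slope_matching_radius:
  assumes n: "n \<ge> 3" and r: "RotSym n r" and nonneg: "0 \<le> mass_excess n r"
  shows "(sch_slope n (boundary_mass n r) (matching_radius n r))\<^sup>2 \<le> sqrt (mass_excess n r)"
proof -
  define \<delta> where "\<delta> = sqrt (mass_excess n r)"
  have \<delta>: "0 \<le> \<delta>" using nonneg by (simp add: \<delta>_def)
  have "sch_slope n (boundary_mass n r) (matching_radius n r) = sqrt (1 - 1 / (1 + \<delta>))"
    using boundary_mass_pos[OF n r] \<delta>
    by (simp add: sch_slope_def matching_radius_power[OF n r nonneg] \<delta>_def)
  moreover have "1 - 1 / (1 + \<delta>) = \<delta> / (1 + \<delta>)" "0 \<le> \<delta> / (1 + \<delta>)" "\<delta> / (1 + \<delta>) \<le> \<delta>"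
    using \<delta> by (auto simp: field_simps)
  ultimately show ?thesis by (simp add: \<delta>_def)
qed

section \<open>Depth\<close>

text \<open>The height above the boundary in the graph that represents the manifold, as a function of the distance
  to the boundary: \<open>dz\<^sup>2 = ds\<^sup>2 - dr\<^sup>2\<close>. Unlike the height as a function of the area radius, it has a
  continuous density.\<close>

definition graph_height :: "(real \<Rightarrow> real) \<Rightarrow> real \<Rightarrow> real" where
  "graph_height r s = integral {0..s} (\<lambda>t. sqrt (1 - (hderiv r t)\<^sup>2))"

lemma
  assumes n: "n \<ge> 3" and r: "RotSym n r"
  shows graph_height_deriv:
      "s > 0 \<Longrightarrow> (graph_height r has_real_derivative sqrt (1 - (hderiv r s)\<^sup>2)) (at s)"
    and graph_height_continuous: "continuous_on {0..} (graph_height r)"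
    and graph_height_mono: "0 \<le> s \<Longrightarrow> s \<le> t \<Longrightarrow> graph_height r s \<le> graph_height r t"
proof -
  define w where "w = (\<lambda>t. sqrt (1 - (hderiv r t)\<^sup>2))"
  have cw: "continuous_on {0..} w"
    unfolding w_def by (intro continuous_intros RotSym_deriv_continuous[OF r])
  have int: "w integrable_on {0..b}" for b
    by (rule integrable_continuous_real[OF continuous_on_subset[OF cw]]) auto
  have gh: "graph_height r = (\<lambda>s. integral {0..s} w)"
    by (simp add: graph_height_def[abs_def] w_def)
  show deriv: "(graph_height r has_real_derivative sqrt (1 - (hderiv r s)\<^sup>2)) (at s)" if "s > 0" for s
  proof -
    have "((\<lambda>u. integral {0..u} w) has_vector_derivative w s) (at s within {0..s + 1})"
      by (rule integral_has_vector_derivative[OF continuous_on_subset[OF cw]]) (use that in auto)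
    moreover have "at s within {0..s + 1} = at s"
      by (rule at_within_interior) (use that in auto)
    ultimately show ?thesis
      unfolding gh by (simp add: has_real_derivative_iff_has_vector_derivative w_def)
  qed
  show cont: "continuous_on {0..} (graph_height r)"
    unfolding gh by (rule continuous_on_halfline) (rule indefinite_integral_continuous_1[OF int])
  show "graph_height r s \<le> graph_height r t" if "0 \<le> s" "s \<le> t"
  proof (rule DERIV_nonneg_imp_increasing_open[OF that(2)])
    show "\<exists>y. (graph_height r has_real_derivative y) (at x) \<and> 0 \<le> y" if "s < x" "x < t" for x
    proof -
      have x: "x > 0" using that \<open>0 \<le> s\<close> by simp
      have "(hderiv r x)\<^sup>2 \<le> 1"
        using hderiv_less_1[OF n r, of x] hderiv_nonneg[OF r, of x] x by (simp add: power_le_one)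
      then show ?thesis using deriv[OF x] by (intro exI conjI) auto
    qed
    show "continuous_on {s..t} (graph_height r)"
      by (rule continuous_on_subset[OF cont]) (use that in auto)
  qed
qed

lemma graph_height_0 [simp]: "graph_height r 0 = 0"
  by (simp add: graph_height_def)

text \<open>The inverse of the profile has infinite slope at \<open>r 0\<close>. Its continuity there comes from compactness of the
  intervals \<open>{0..b}\<close>.\<close>

lemma
  assumes r: "RotSym n r"
  defines "g \<equiv> the_inv_into {0..} r"
  shows inverse_profile: "s \<ge> 0 \<Longrightarrow> g (r s) = s"
    and inverse_profile_deriv: "s > 0 \<Longrightarrow> (g has_real_derivative inverse (hderiv r s)) (at (r s))"
    and inverse_profile_continuous: "continuous_on (r ` {0..}) g"
    and interior_profile_image: "s > 0 \<Longrightarrow> r s \<in> interior (r ` {0..})"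
proof -
  have g: "g (r s) = s" if "s \<ge> 0" for s
    unfolding g_def using the_inv_into_f_f[OF RotSym_inj_on[OF r]] that by simp
  then show "s \<ge> 0 \<Longrightarrow> g (r s) = s" .
  show "(g has_real_derivative inverse (hderiv r s)) (at (r s))" if "s > 0"
  proof (rule DERIV_left_inverse[where S = "{0<..}" and f = r and x = s])
    show "continuous_on {0<..} r"
      by (rule continuous_on_subset[OF RotSym_continuous[OF r]]) auto
    show "hderiv r s \<noteq> 0" using r that by (auto simp: RotSym_def)
  qed (use that g RotSym_deriv[OF r] in auto)
  have Icc: "r ` {0..b} = {r 0..r b}" if "b \<ge> 0" for b
  proof
    show "r ` {0..b} \<subseteq> {r 0..r b}" using RotSym_mono[OF r] by auto
    show "{r 0..r b} \<subseteq> r ` {0..b}"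
      using IVT'[of r 0 _ b] that continuous_on_subset[OF RotSym_continuous[OF r], of "{0..b}"]
      by (fastforce simp: image_iff)
  qed
  show "continuous_on (r ` {0..}) g"
    unfolding continuous_on_eq_continuous_within
  proof clarsimp
    fix s :: real assume s: "s \<ge> 0"
    have 1: "continuous_on (r ` {0..s + 1}) g"
      by (rule continuous_on_inv[OF continuous_on_subset[OF RotSym_continuous[OF r]]])
         (use g in auto)
    have "x \<in> r ` {0..s + 1}" if x: "x \<in> r ` {0..}" "x < r (s + 1)" for x
    proof -
      obtain t where t: "t \<ge> 0" "x = r t" using x by auto
      then have "t \<le> s + 1" using RotSym_mono[OF r, of "s + 1" t] x(2) s by linarith
      then show ?thesis using t by auto
    qed
    moreover have "r ` {0..s + 1} \<subseteq> r ` {0..}" by (rule image_mono) auto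
    ultimately have "at (r s) within r ` {0..} = at (r s) within r ` {0..s + 1}"
      using RotSym_strict_mono[OF r s, of "s + 1"] Icc[of "s + 1"] s
      by (intro at_within_nhd[of _ "{..<r (s + 1)}"]) auto
    then show "continuous (at (r s) within r ` {0..}) g"
      using 1 s by (auto simp: continuous_on_eq_continuous_within)
  qed
  show "r s \<in> interior (r ` {0..})" if s: "s > 0"
  proof (rule interiorI[of "{r 0<..<r (s + 1)}"])
    show "{r 0<..<r (s + 1)} \<subseteq> r ` {0..}" using Icc[of "s + 1"] s by force
  qed (use RotSym_strict_mono[OF r] s in auto)
qed

lemma height_function_graph_height:
  assumes n: "n \<ge> 3" and r: "RotSym n r"
  shows "height_function r (\<lambda>x. graph_height r (the_inv_into {0..} r x) + c)"
proof -
  define g where "g = the_inv_into {0..} r"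
  note g = inverse_profile[OF r, folded g_def] and g_deriv = inverse_profile_deriv[OF r, folded g_def]
  have "continuous_on (r ` {0..}) (\<lambda>x. graph_height r (g x) + c)"
    by (intro continuous_intros continuous_on_compose2[OF graph_height_continuous[OF n r]
          inverse_profile_continuous[OF r, folded g_def]]) (auto simp: g)
  moreover have "mono_on (r ` {0..}) (\<lambda>x. graph_height r (g x) + c)"
  proof (rule mono_onI)
    fix x y assume "x \<in> r ` {0..}" "y \<in> r ` {0..}" and xy: "x \<le> y"
    then obtain s t where st: "s \<ge> 0" "t \<ge> 0" "x = r s" "y = r t" by auto
    then have "s \<le> t" using RotSym_strict_mono[OF r st(2), of s] xy by (meson not_le)
    then show "graph_height r (g x) + c \<le> graph_height r (g y) + c"
      using graph_height_mono[OF n r st(1)] st by (simp add: g)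
  qed
  moreover have "(\<lambda>x. graph_height r (g x) + c) differentiable (at x) \<and>
      1 + (deriv (\<lambda>x. graph_height r (g x) + c) x)\<^sup>2 = (deriv g x)\<^sup>2" if x: "x \<in> r ` {0<..}" for x
  proof -
    obtain s where s: "s > 0" "x = r s" using x by auto
    have pos: "hderiv r s > 0" "hderiv r s < 1"
      using r s hderiv_less_1[OF n r, of s] by (auto simp: RotSym_def)
    have "(graph_height r has_real_derivative sqrt (1 - (hderiv r s)\<^sup>2)) (at (g x))"
      using graph_height_deriv[OF n r s(1)] s by (simp add: g)
    from DERIV_chain2[OF this g_deriv[OF s(1), folded s(2)]]
    have d: "((\<lambda>x. graph_height r (g x) + c) has_real_derivative
        sqrt (1 - (hderiv r s)\<^sup>2) * inverse (hderiv r s)) (at x)"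
      by (auto intro!: derivative_eq_intros)
    have "1 + (sqrt (1 - (hderiv r s)\<^sup>2) * inverse (hderiv r s))\<^sup>2 = (inverse (hderiv r s))\<^sup>2"
      using pos by (simp add: power_mult_distrib power_le_one field_simps)
    moreover have "deriv g x = inverse (hderiv r s)"
      using g_deriv[OF s(1)] s(2) by (simp add: DERIV_imp_deriv)
    ultimately show ?thesis
      using d DERIV_imp_deriv[OF d] real_differentiable_def by metis
  qed
  ultimately show ?thesis
    by (simp add: height_function_def Let_def g_def)
qed

text \<open>Monotonicity fixes the sign of the derivative of \<open>z\<close>, so that \<open>z \<circ> r\<close> and the graph height have the same
  derivative; continuity carries the equality to the boundary.\<close>

lemma height_function_unique:
  assumes n: "n \<ge> 3" and r: "RotSym n r" and z: "height_function r z" and s: "s \<ge> 0"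
  shows "z (r s) = z (r 0) + graph_height r s"
proof (cases "s = 0")
  case False
  define g where "g = the_inv_into {0..} r"
  have zc: "continuous_on (r ` {0..}) z" and zm: "mono_on (r ` {0..}) z"
    and zd: "\<And>x. x \<in> r ` {0<..} \<Longrightarrow> z differentiable (at x) \<and> 1 + (deriv z x)\<^sup>2 = (deriv g x)\<^sup>2"
    using z by (auto simp: height_function_def Let_def g_def)
  have "z (r s) - graph_height r s = z (r 0) - graph_height r 0"
  proof (rule DERIV_isconst_end[where a = 0])
    show "0 < s" using s False by simp
    show "continuous_on {0..s} (\<lambda>s. z (r s) - graph_height r s)"
      by (intro continuous_intros continuous_on_compose2[OF zc]
          continuous_on_subset[OF RotSym_continuous[OF r]]
          continuous_on_subset[OF graph_height_continuous[OF n r]]) auto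
    fix t assume "0 < t" "t < s"
    then have t: "t > 0" by simp
    have pos: "hderiv r t > 0" "hderiv r t < 1"
      using r t hderiv_less_1[OF n r, of t] by (auto simp: RotSym_def)
    have dz: "(z has_real_derivative deriv z (r t)) (at (r t))"
      using zd[of "r t"] t by (auto simp: DERIV_deriv_iff_real_differentiable)
    have nonneg: "deriv z (r t) \<ge> 0"
      by (rule mono_on_imp_deriv_nonneg[OF zm dz interior_profile_image[OF r t]])
    have "deriv g (r t) = inverse (hderiv r t)"
      using inverse_profile_deriv[OF r t, folded g_def] by (rule DERIV_imp_deriv)
    then have "1 + (deriv z (r t))\<^sup>2 = (inverse (hderiv r t))\<^sup>2"
      using zd[of "r t"] t by simp
    then have "(deriv z (r t) * hderiv r t)\<^sup>2 = 1 - (hderiv r t)\<^sup>2"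
      using pos by (simp add: field_simps power_mult_distrib)
    then have "deriv z (r t) * hderiv r t = sqrt (1 - (hderiv r t)\<^sup>2)"
      using nonneg pos by (metis less_imp_le mult_nonneg_nonneg real_sqrt_unique)
    moreover have "((\<lambda>s. z (r s)) has_real_derivative deriv z (r t) * hderiv r t) (at t)"
      by (rule DERIV_chain2[OF dz RotSym_deriv[OF r t]])
    ultimately show "((\<lambda>s. z (r s) - graph_height r s) has_real_derivative 0) (at t)"
      using DERIV_diff graph_height_deriv[OF n r t] by fastforce
  qed
  then show ?thesis by simp
qed simp

text \<open>The height functions are the translates of the graph height, and the matching condition selects one
  of them; so the description of the depth determines it.\<close>

lemma depth_eq:
  assumes n: "n \<ge> 3" and r: "RotSym n r" and s: "s \<ge> 0" "r s = matching_radius n r"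
  shows "depth n r = graph_height r s - sch_height n (boundary_mass n r) (r s)"
  unfolding depth_def
proof (rule the_equality)
  define c where "c = sch_height n (boundary_mass n r) (r s) - graph_height r s"
  define z where "z = (\<lambda>x. graph_height r (the_inv_into {0..} r x) + c)"
  have zr: "z (r t) = graph_height r t + c" if "t \<ge> 0" for t
    using inverse_profile[OF r that] by (simp add: z_def)
  have "height_function r z"
    unfolding z_def by (rule height_function_graph_height[OF n r])
  moreover have "z (matching_radius n r) = sch_height n (boundary_mass n r) (matching_radius n r)"
    using zr[OF s(1)] by (simp add: s(2) c_def)
  moreover have "graph_height r s - sch_height n (boundary_mass n r) (r s) = - z (r 0)"
    by (simp add: zr c_def)
  ultimately show "\<exists>z. height_function r z \<and>
      z (matching_radius n r) = sch_height n (boundary_mass n r) (matching_radius n r) \<and>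
      graph_height r s - sch_height n (boundary_mass n r) (r s) = - z (r 0)"
    by blast
next
  fix L assume "\<exists>z. height_function r z \<and>
      z (matching_radius n r) = sch_height n (boundary_mass n r) (matching_radius n r) \<and> L = - z (r 0)"
  then obtain z where z: "height_function r z"
      "z (r s) = sch_height n (boundary_mass n r) (r s)" "L = - z (r 0)"
    by (auto simp: s(2))
  show "L = graph_height r s - sch_height n (boundary_mass n r) (r s)"
    using height_function_unique[OF n r z(1) s(1)] z(2,3) by simp
qed

text \<open>The function \<open>(1 - sqrt (1 - x\<^sup>2)) / x = x / (1 + sqrt (1 - x\<^sup>2))\<close> is increasing and at most \<open>x\<close>. It is
  arc length minus height, per unit of area radius, of a graph along which the area radius has slope \<open>x\<close> in arc length.\<close>

lemma slope_defect_bounds: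
  fixes y \<sigma> :: real
  assumes y: "0 \<le> y" "y \<le> \<sigma>" and \<sigma>: "0 < \<sigma>" "\<sigma> < 1"
  shows "0 \<le> (1 - sqrt (1 - \<sigma>\<^sup>2)) / \<sigma> * y - (1 - sqrt (1 - y\<^sup>2))"
    and "(1 - sqrt (1 - \<sigma>\<^sup>2)) / \<sigma> * y - (1 - sqrt (1 - y\<^sup>2)) \<le> \<sigma>"
proof -
  have eq: "1 - sqrt (1 - x\<^sup>2) = x * (x / (1 + sqrt (1 - x\<^sup>2)))" if "0 \<le> x" "x < 1" for x :: real
  proof -
    have "x\<^sup>2 \<le> 1" using that by (simp add: power_le_one)
    then have "(1 - sqrt (1 - x\<^sup>2)) * (1 + sqrt (1 - x\<^sup>2)) = x * x"
      by (simp add: algebra_simps power2_eq_square)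
    moreover have "1 + sqrt (1 - x\<^sup>2) > 0"
      using \<open>x\<^sup>2 \<le> 1\<close> by (simp add: add_pos_nonneg)
    ultimately show ?thesis by (simp add: field_simps)
  qed
  define c where "c = \<sigma> / (1 + sqrt (1 - \<sigma>\<^sup>2))"
  have sq: "y\<^sup>2 \<le> \<sigma>\<^sup>2" "\<sigma>\<^sup>2 \<le> 1" using y \<sigma> by (auto simp: power_mono power_le_one)
  have c\<sigma>: "(1 - sqrt (1 - \<sigma>\<^sup>2)) / \<sigma> = c" using eq[of \<sigma>] \<sigma> by (simp add: c_def)
  have y_eq: "1 - sqrt (1 - y\<^sup>2) = y * (y / (1 + sqrt (1 - y\<^sup>2)))" using eq[of y] y \<sigma> by simp
  have "y / (1 + sqrt (1 - y\<^sup>2)) \<le> c"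
    unfolding c_def using y \<sigma> sq by (intro frac_le add_left_mono real_sqrt_le_mono add_pos_nonneg) auto
  then have "1 - sqrt (1 - y\<^sup>2) \<le> c * y"
    unfolding y_eq mult.commute[of c] using y by (intro mult_left_mono) auto
  then show "0 \<le> (1 - sqrt (1 - \<sigma>\<^sup>2)) / \<sigma> * y - (1 - sqrt (1 - y\<^sup>2))" by (simp add: c\<sigma>)
  have "c \<le> \<sigma>" unfolding c_def using \<sigma> sq by (simp add: divide_le_eq add_pos_nonneg)
  then have "c * y \<le> \<sigma> * 1" using y \<sigma> by (intro mult_mono) auto
  moreover have "0 \<le> 1 - sqrt (1 - y\<^sup>2)" by simp
  ultimately show "(1 - sqrt (1 - \<sigma>\<^sup>2)) / \<sigma> * y - (1 - sqrt (1 - y\<^sup>2)) \<le> \<sigma>"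
    unfolding c\<sigma> by linarith
qed

text \<open>For \<open>s\<close> the distance of the matching sphere from the boundary, \<open>D\<close> is the length of the inner part
  of the appended Schwarzschild space minus that of the inner part of \<open>M\<close>. As a
  function of \<open>s\<close> it starts at \<open>0\<close>, and its derivative compares the excess of arc length over height in the two graphs.\<close>

lemma length_mismatch:
  assumes n: "n \<ge> 3" and r: "RotSym n r" and s: "s \<ge> 0"
  defines "m \<equiv> boundary_mass n r"
  defines "D \<equiv> sch_arclength n m (r s) - sch_height n m (r s) + graph_height r s - s"
  shows "0 \<le> D" "D \<le> sch_slope n m (r s) * s"
proof -
  define F where "F = (\<lambda>t. sch_arclength n m (r t) - sch_height n m (r t) + graph_height r t - t)"
  define b where "b = sch_slope n m (r s)"
  have m: "m > 0" using boundary_mass_pos[OF n r] by (simp add: m_def)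
  have R: "sch_radius n m = r 0" using sch_radius_boundary_mass[OF n r] by (simp add: m_def)
  have r_in: "r 0 \<le> r t" if "t \<ge> 0" for t using RotSym_mono[OF r order_refl that] .
  have F0: "F 0 = 0"
    using sch_arclength_horizon[of n m] sch_height_horizon[of n m] by (simp add: F_def R)
  have FD: "F s = D" by (simp add: F_def D_def)
  have cF: "continuous_on {0..s} F"
    unfolding F_def
    by (intro continuous_intros continuous_on_compose2[OF sch_arclength_continuous[OF n m]]
        continuous_on_compose2[OF sch_height_continuous[OF n m]]
        continuous_on_subset[OF RotSym_continuous[OF r]]
        continuous_on_subset[OF graph_height_continuous[OF n r]]) (use r_in R in auto)
  have F': "\<exists>d. (F has_real_derivative d) (at t) \<and> 0 \<le> d \<and> d \<le> b" if t: "0 < t" "t < s" for t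
  proof -
    define \<sigma> y where "\<sigma> = sch_slope n m (r t)" and "y = hderiv r t"
    have rt: "sch_radius n m < r t" using RotSym_strict_mono[OF r order_refl t(1)] R by simp
    have \<sigma>: "0 < \<sigma>" "\<sigma> < 1" using sch_slope_bounds[OF n m rt] by (auto simp: \<sigma>_def)
    have y: "0 \<le> y" "y \<le> \<sigma>"
      using hderiv_nonneg[OF r] hderiv_le_sch_slope[OF n r] t by (auto simp: y_def \<sigma>_def m_def)
    (* Both graphs are traversed at the same area radius r t, with slopes \<sigma> and y. *)
    have "\<sigma> \<le> b"
      unfolding \<sigma>_def b_def using RotSym_mono[OF r] t by (intro sch_slope_mono[OF n m rt]) auto
    moreover have "(F has_real_derivative
        1 / \<sigma> * y - sqrt (1 - \<sigma>\<^sup>2) / \<sigma> * y + sqrt (1 - y\<^sup>2) - 1) (at t)"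
      unfolding F_def \<sigma>_def y_def
      by (intro DERIV_diff DERIV_add DERIV_ident graph_height_deriv[OF n r t(1)]
          DERIV_chain2[OF sch_arclength_deriv[OF n m rt] RotSym_deriv[OF r t(1)]]
          DERIV_chain2[OF sch_height_deriv[OF n m rt] RotSym_deriv[OF r t(1)]])
    moreover have "1 / \<sigma> * y - sqrt (1 - \<sigma>\<^sup>2) / \<sigma> * y + sqrt (1 - y\<^sup>2) - 1
        = (1 - sqrt (1 - \<sigma>\<^sup>2)) / \<sigma> * y - (1 - sqrt (1 - y\<^sup>2))"
      by (simp add: diff_divide_distrib algebra_simps)
    ultimately show ?thesis
      using slope_defect_bounds[OF y \<sigma>] by (metis order_trans)
  qed
  have "F 0 \<le> F s"
    by (rule DERIV_nonneg_imp_increasing_open[OF s _ cF]) (use F' in blast)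
  then show "0 \<le> D" by (simp add: F0 FD)
  have "b * 0 - F 0 \<le> b * s - F s"
  proof (rule DERIV_nonneg_imp_increasing_open[OF s])
    fix t assume "0 < t" "t < s"
    then obtain d where d: "(F has_real_derivative d) (at t)" "d \<le> b" using F' by blast
    show "\<exists>y. ((\<lambda>t. b * t - F t) has_real_derivative y) (at t) \<and> 0 \<le> y"
      using DERIV_diff[OF DERIV_cmult_Id d(1)] d(2) by (intro exI[of _ "b - d"]) simp
  qed (intro continuous_intros cF)
  then show "D \<le> sch_slope n m (r s) * s" by (simp add: F0 FD b_def)
qed

section \<open>The comparison map\<close>

text \<open>The rigid case of vanishing mass excess, where the matching sphere is the boundary and there is no
  inner part: the profiles coincide and the identity is an isometry.\<close>

lemma schwarzschild_distance_matched:
  assumes n: "CARD('n::finite) \<ge> 3" and r: "RotSym CARD('n) r"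
    and vanish: "r 0 = matching_radius CARD('n) r"
    and slope: "\<And>s. s > 0 \<Longrightarrow> sch_slope CARD('n) (boundary_mass CARD('n) r) (r s) \<le> hderiv r s"
    and K: "K \<ge> 1"
  shows "lipschitz_distance
     (rot_space 0 :: (real \<times> (real ^ 'n)) set) (rot_dist 0 r)
     (rot_space (- depth CARD('n) r) :: (real \<times> (real ^ 'n)) set)
     (rot_dist (- depth CARD('n) r) (appended_sch_profile CARD('n) (boundary_mass CARD('n) r)))
     \<le> ereal (2 * ln K)"
proof -
  define m where "m = boundary_mass CARD('n) r"
  have m: "m > 0" using boundary_mass_pos[OF n r] by (simp add: m_def)
  have R: "sch_radius CARD('n) m = r 0"
    using sch_radius_boundary_mass[OF n r] by (simp add: m_def)
  have r_in: "sch_radius CARD('n) m \<le> r s" if "s \<ge> 0" for s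
    using RotSym_mono[OF r order_refl that] by (simp add: R)
  have L: "depth CARD('n) r = 0"
    using depth_eq[OF n r order_refl vanish] sch_height_horizon[of "CARD('n)" m]
    by (simp add: R flip: m_def)
  have A: "sch_arclength CARD('n) m (r s) = s" if s: "s \<ge> 0" for s
  proof (cases "s = 0")
    case True
    then show ?thesis using sch_arclength_horizon[of "CARD('n)" m] by (simp add: R)
  next
    case False
    have "sch_arclength CARD('n) m (r s) - s = sch_arclength CARD('n) m (r 0) - 0"
    proof (rule DERIV_isconst_end[where a = 0])
      show "0 < s" using s False by simp
      show "continuous_on {0..s} (\<lambda>s. sch_arclength CARD('n) m (r s) - s)"
        by (intro continuous_intros continuous_on_compose2[OF sch_arclength_continuous[OF n m]]
            continuous_on_subset[OF RotSym_continuous[OF r]]) (use r_in in auto)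
      fix t assume "0 < t" "t < s"
      then have t: "t > 0" by simp
      have rt: "sch_radius CARD('n) m < r t" using RotSym_strict_mono[OF r order_refl t] by (simp add: R)
      have eq: "hderiv r t = sch_slope CARD('n) m (r t)"
        using slope[OF t] hderiv_le_sch_slope[OF n r, of t] t by (simp add: m_def)
      have "((\<lambda>s. sch_arclength CARD('n) m (r s) - s) has_real_derivative
          1 / sch_slope CARD('n) m (r t) * hderiv r t - 1) (at t)"
        by (intro DERIV_diff DERIV_ident
            DERIV_chain2[OF sch_arclength_deriv[OF n m rt] RotSym_deriv[OF r t]])
      then show "((\<lambda>s. sch_arclength CARD('n) m (r s) - s) has_real_derivative 0) (at t)"
        using sch_slope_bounds(2)[OF n m rt] by (simp add: eq)
    qed
    then show ?thesis using sch_arclength_horizon[of "CARD('n)" m] by (simp add: R)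
  qed
  have P: "appended_sch_profile CARD('n) m s = r s" if "s \<ge> 0" for s
    using appended_sch_profile_arclength[OF n m r_in[OF that]] A[OF that] by simp
  have r_pos: "r s > 0" if "s \<ge> 0" for s using r that by (simp add: RotSym_def)
  have "lipschitz_distance
     (rot_space 0 :: (real \<times> (real ^ 'n)) set) (rot_dist 0 r)
     (rot_space ((\<lambda>s. s) 0) :: (real \<times> (real ^ 'n)) set)
     (rot_dist ((\<lambda>s. s) 0) (appended_sch_profile CARD('n) m)) \<le> ereal (2 * ln K)"
  proof (rule radial_map_lipschitz_distance[where f' = "\<lambda>_. 1"])
    show "continuous_on {0..} (appended_sch_profile CARD('n) m)"
      by (rule continuous_on_subset[OF appended_sch_profile_continuous[OF n m]]) simp
    show "appended_sch_profile CARD('n) m s \<le> K * r s" "r s \<le> K * appended_sch_profile CARD('n) m s"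
      if "s \<ge> 0" for s
      using P[OF that] r_pos[OF that] K by simp_all
  qed (use n K r_pos RotSym_continuous[OF r] in auto)
  then show ?thesis by (simp add: L m_def)
qed

text \<open>Here \<open>\<eta>\<close> is a bound for the fourth root of the mass excess. It controls the three deviations from an
  isometry: the slope ratio outside the matching sphere is at least \<open>1 - \<eta>\<close>, the
  relative mismatch of the inner lengths is at most \<open>\<eta>\<close>, and the area radii on the inner part vary by a factor of at most \<open>1 + \<eta>\<^sup>2\<close>.\<close>

lemma schwarzschild_distance_bound:
  assumes n: "CARD('n::finite) \<ge> 3" and r: "RotSym CARD('n) r"
    and fin: "ADM_mass CARD('n) r \<le> ereal ((1 + d) * boundary_mass CARD('n) r)"
    and match: "matching_radius CARD('n) r \<in> r ` {0..}"
    and \<eta>: "0 < \<eta>" "\<eta> \<le> 1 / 2" "d \<le> \<eta> ^ 4"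
    and K: "1 + 3 * \<eta> \<le> K"
  shows "lipschitz_distance
     (rot_space 0 :: (real \<times> (real ^ 'n)) set) (rot_dist 0 r)
     (rot_space (- depth CARD('n) r) :: (real \<times> (real ^ 'n)) set)
     (rot_dist (- depth CARD('n) r) (appended_sch_profile CARD('n) (boundary_mass CARD('n) r)))
     \<le> ereal (2 * ln K)"
proof -
  define m x L where "m = boundary_mass CARD('n) r" and "x = matching_radius CARD('n) r"
    and "L = depth CARD('n) r"
  define R where "R = r 0"
  define P where "P = appended_sch_profile CARD('n) m"
  define A where "A = sch_arclength CARD('n) m"
  define \<sigma> where "\<sigma> = sch_slope CARD('n) m"
  have K1: "K \<ge> 1" using K \<eta> by simp
  have m: "m > 0" using boundary_mass_pos[OF n r] by (simp add: m_def)
  have R: "sch_radius CARD('n) m = R"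
    using sch_radius_boundary_mass[OF n r] by (simp add: m_def R_def)
  have R0: "R > 0" using r by (simp add: RotSym_def R_def)
  have ex: "0 \<le> mass_excess CARD('n) r" by (rule mass_excess_nonneg[OF n r fin])
  have "mass_excess CARD('n) r \<le> (\<eta>\<^sup>2)\<^sup>2"
    using mass_excess_le[OF n r fin] \<eta>(3) by simp
  then have \<delta>: "sqrt (mass_excess CARD('n) r) \<le> \<eta>\<^sup>2"
    by (intro real_le_lsqrt) auto
  have \<eta>2: "\<eta>\<^sup>2 \<le> \<eta> / 2"
    using \<eta> mult_left_mono[of \<eta> "1/2" \<eta>] by (simp add: power2_eq_square)
  have "sqrt (mass_excess CARD('n) r) < 1" using \<delta> \<eta>2 \<eta> by linarith
  then have ex1: "mass_excess CARD('n) r < 1" by simp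
  have inv_K: "1 \<le> K * (1 - \<eta>)"
  proof -
    have "1 \<le> (1 + 3 * \<eta>) * (1 - \<eta>)" using \<eta>2 \<eta> by (simp add: algebra_simps power2_eq_square)
    also have "\<dots> \<le> K * (1 - \<eta>)" using K \<eta> by (intro mult_right_mono) auto
    finally show ?thesis .
  qed
  obtain s1 where s1: "s1 \<ge> 0" "r s1 = x" using match by (auto simp: x_def)
  have slope_low: "(1 - \<eta>) * \<sigma> (r s) \<le> hderiv r s" if "s \<ge> s1" for s
  proof -
    have s0: "s \<ge> 0" and xs: "x \<le> r s"
      using that s1 RotSym_mono[OF r s1(1) that] by auto
    have "0 \<le> \<sigma> (r s)"
      using hderiv_le_sch_slope[OF n r s0] hderiv_nonneg[OF r s0] by (simp add: \<sigma>_def m_def)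
    then have "(1 - \<eta>) * \<sigma> (r s) \<le> (1 - sqrt (mass_excess CARD('n) r)) * \<sigma> (r s)"
      using \<delta> \<eta>2 \<eta> by (intro mult_right_mono) auto
    also have "\<dots> \<le> hderiv r s"
      unfolding \<sigma>_def m_def
      by (rule hderiv_ge_sch_slope[OF n r fin ex1 s0]) (use xs in \<open>simp add: x_def\<close>)
    finally show ?thesis .
  qed
  show ?thesis
  proof (cases "mass_excess CARD('n) r = 0")
    case True
    then have x: "r 0 = matching_radius CARD('n) r"
      using r by (simp add: matching_radius_def)
    show ?thesis
    proof (rule schwarzschild_distance_matched[OF n r x _ K1])
      fix s :: real assume "s > 0"
      then show "sch_slope CARD('n) (boundary_mass CARD('n) r) (r s) \<le> hderiv r s"
        using hderiv_ge_sch_slope[OF n r fin ex1, of s] RotSym_mono[OF r order_refl, of s] True x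
        by simp
    qed
  next
    case False
    with ex have "0 < mass_excess CARD('n) r" by simp
    then have Rx: "R < x"
      using matching_radius_bounds(3)[OF n r ex] by (simp add: R_def x_def)
    with s1 have s1_pos: "s1 > 0" using R_def by (cases "s1 = 0") auto
    have xK: "x \<le> K * R"
    proof -
      have "x \<le> (1 + sqrt (mass_excess CARD('n) r)) * R"
        using matching_radius_bounds(2)[OF n r ex] by (simp add: x_def R_def)
      also have "\<dots> \<le> K * R"
        using \<delta> \<eta>2 \<eta> K R0 by (intro mult_right_mono) auto
      finally show ?thesis .
    qed
    define D where "D = L + A x - s1"
    have L: "L = graph_height r s1 - sch_height CARD('n) m x"
      using depth_eq[OF n r s1(1)] s1(2) by (simp add: L_def m_def x_def)
    have "0 \<le> D" "D \<le> \<sigma> x * s1"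
      using length_mismatch[OF n r s1(1)] by (simp_all add: D_def L A_def \<sigma>_def m_def s1(2))
    moreover have "\<sigma> x \<le> \<eta>"
    proof (rule power2_le_imp_le)
      show "(\<sigma> x)\<^sup>2 \<le> \<eta>\<^sup>2"
        using sch_slope_matching_radius[OF n r ex] \<delta> by (simp add: \<sigma>_def m_def x_def)
    qed (use \<eta> in simp)
    ultimately have D: "0 \<le> D" "D \<le> \<eta> * s1"
      using s1_pos by (auto intro: order_trans mult_right_mono)
    define a where "a = (L + A x) / s1"
    have a: "1 \<le> a" "a \<le> 1 + \<eta>" "a * s1 = L + A x"
      using D s1_pos by (auto simp: a_def D_def field_simps)
    have slope: "0 < \<sigma> (r s)" "1 - \<eta> \<le> hderiv r s / \<sigma> (r s)" "hderiv r s / \<sigma> (r s) \<le> 1"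
      if "s \<ge> s1" for s
    proof -
      have s0: "s \<ge> 0" using that s1 by simp
      have "sch_radius CARD('n) m < r s"
        using RotSym_mono[OF r s1(1) that] Rx s1 by (simp add: R)
      then show pos: "0 < \<sigma> (r s)" unfolding \<sigma>_def by (rule sch_slope_bounds(2)[OF n m])
      show "1 - \<eta> \<le> hderiv r s / \<sigma> (r s)"
        using slope_low[OF that] pos by (simp add: le_divide_eq)
      show "hderiv r s / \<sigma> (r s) \<le> 1"
        using hderiv_le_sch_slope[OF n r s0] pos by (simp add: \<sigma>_def m_def)
    qed
    define \<kappa> where "\<kappa> = hderiv r s1 / \<sigma> x"
    have \<kappa>: "1 - \<eta> \<le> \<kappa>" "\<kappa> \<le> 1" using slope[of s1] by (auto simp: \<kappa>_def s1(2))
    (* The derivative q' is affine with average a on [0, s1] and with value \<kappa>, the slope of the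
       outer map, at s1. *)
    define q where "q = (\<lambda>s. (2 * a - \<kappa>) * s - (a - \<kappa>) * s\<^sup>2 / s1 - L)"
    define q' where "q' = (\<lambda>s. (2 * a - \<kappa>) - 2 * (a - \<kappa>) * s / s1)"
    define f where "f = (\<lambda>s. if s \<le> s1 then q s else A (r s))"
    define f' where "f' = (\<lambda>s. if s \<le> s1 then q' s else hderiv r s / \<sigma> (r s))"
    have q: "(q has_real_derivative q' s) (at s)" for s
      unfolding q_def q'_def using s1_pos by (auto intro!: derivative_eq_intros simp: field_simps)
    have Ar: "((\<lambda>s. A (r s)) has_real_derivative hderiv r s / \<sigma> (r s)) (at s)" if "s \<ge> s1" for s
    proof -
      have "sch_radius CARD('n) m < r s" "s > 0"
        using RotSym_mono[OF r s1(1) that] Rx s1 s1_pos that by (auto simp: R)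
      from DERIV_chain2[OF sch_arclength_deriv[OF n m this(1)] RotSym_deriv[OF r this(2)]]
      show ?thesis by (simp add: A_def \<sigma>_def)
    qed
    have q'_end: "q' s1 = \<kappa>" using s1_pos by (simp add: q'_def)
    have q_end: "q s1 = A x"
    proof -
      have "(a - \<kappa>) * s1\<^sup>2 / s1 = (a - \<kappa>) * s1" using s1_pos by (simp add: power2_eq_square)
      then show ?thesis using a(3) unfolding q_def by (simp add: algebra_simps)
    qed
    have f_deriv: "(f has_real_derivative f' s) (at s)" for s
    proof (cases s s1 rule: linorder_cases)
      case less
      have "(f has_real_derivative q' s) (at s)"
        by (rule DERIV_cong_ev[THEN iffD2, OF refl _ refl q])
           (use less in \<open>auto simp: f_def intro: eventually_nhds_in_open[of "{..<s1}", THEN eventually_mono]\<close>)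
      then show ?thesis using less by (simp add: f'_def)
    next
      case equal
      then show ?thesis
        using DERIV_If_le[OF q[of s1], of "\<lambda>s. A (r s)"] Ar[of s1] q_end q'_end
        by (simp add: f_def f'_def \<kappa>_def s1(2))
    next
      case greater
      have "(f has_real_derivative hderiv r s / \<sigma> (r s)) (at s)"
        by (rule DERIV_cong_ev[THEN iffD2, OF refl _ refl Ar])
           (use greater in \<open>auto simp: f_def intro: eventually_nhds_in_open[of "{s1<..}", THEN eventually_mono]\<close>)
      then show ?thesis using greater by (simp add: f'_def)
    qed
    have q'_ge: "1 - \<eta> \<le> q' s" if "s \<le> s1" for s
    proof -
      have "2 * (a - \<kappa>) * s / s1 \<le> 2 * (a - \<kappa>) * s1 / s1"
        using that s1_pos a \<kappa> by (intro divide_right_mono mult_left_mono) auto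
      then show ?thesis using s1_pos \<kappa> by (simp add: q'_def)
    qed
    have q'_le: "q' s \<le> 1 + 3 * \<eta>" if "s \<ge> 0" for s
    proof -
      have "0 \<le> 2 * (a - \<kappa>) * s / s1" using that s1_pos a \<kappa> by simp
      then show ?thesis using a \<kappa> by (simp add: q'_def)
    qed
    have f'_ge: "1 - \<eta> \<le> f' s" for s
      using q'_ge slope by (auto simp: f'_def)
    have f'_le: "f' s \<le> K" if "s \<ge> 0" for s
      using q'_le[OF that] slope(3)[of s] K K1 by (auto simp: f'_def)
    have f'_pos: "f' s > 0" for s using f'_ge[of s] \<eta> by simp
    have f'_cont: "continuous_on {0..} f'"
    proof -
      have "continuous_on {0..s1} q'" unfolding q'_def by (intro continuous_intros) (use s1_pos in auto)
      moreover have "continuous_on {s1..} (\<lambda>s. hderiv r s / \<sigma> (r s))"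
      proof (intro continuous_intros)
        show "continuous_on {s1..} (hderiv r)"
          by (rule continuous_on_subset[OF RotSym_deriv_continuous[OF r]]) (use s1 in auto)
        show "continuous_on {s1..} (\<lambda>s. \<sigma> (r s))"
          unfolding \<sigma>_def
          by (rule continuous_on_compose2[OF sch_slope_continuous
                continuous_on_subset[OF RotSym_continuous[OF r]]])
             (use s1 r in \<open>auto simp: RotSym_def\<close>)
        show "\<forall>s\<in>{s1..}. \<sigma> (r s) \<noteq> 0" using slope(1) by force
      qed
      ultimately have "continuous_on ({0..s1} \<union> {s1..}) f'"
        unfolding f'_def
        by (intro continuous_on_If) (auto simp: q'_end \<kappa>_def s1(2))
      moreover have "{0..s1} \<union> {s1..} = {0..}" using s1 by auto
      ultimately show ?thesis by simp
    qed
    have f_mono: "f s \<le> f t" if "s \<le> t" for s t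
      by (rule DERIV_nonneg_imp_nondecreasing[OF that]) (use f_deriv f'_pos less_imp_le in blast)
    have f_cont: "continuous_on UNIV f"
      using f_deriv by (meson DERIV_continuous continuous_at_imp_continuous_on)
    have Pf_cont: "continuous_on {0..} (\<lambda>s. P (f s))"
      unfolding P_def
      by (rule continuous_on_compose2[OF appended_sch_profile_continuous[OF n m]
            continuous_on_subset[OF f_cont]]) auto
    (* On the inner part both radii lie in [R, x]; on the outer part they agree. *)
    have radii: "P (f s) \<le> K * r s \<and> r s \<le> K * P (f s)" if s: "s \<ge> 0" for s
    proof (cases "s \<le> s1")
      case True
      have Rr: "R \<le> r s" and rx: "r s \<le> x"
        using RotSym_mono[OF r order_refl s] RotSym_mono[OF r s True] s1 by (auto simp: R_def)
      have "f s \<le> A x" using f_mono[OF True] q_end by (simp add: f_def)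
      then have "R \<le> P (f s)" "P (f s) \<le> x"
        using appended_sch_profile_bounds[OF n m, of x "f s"] Rx by (auto simp: P_def A_def R)
      moreover have "K * R \<le> K * r s" "K * R \<le> K * P (f s)"
        using Rr \<open>R \<le> P (f s)\<close> K1 by (auto intro: mult_left_mono)
      ultimately show ?thesis using xK rx by linarith
    next
      case False
      have Rr: "sch_radius CARD('n) m \<le> r s"
        using RotSym_mono[OF r order_refl s] by (simp add: R R_def)
      have "P (f s) = r s"
        using appended_sch_profile_arclength[OF n m Rr] False by (simp add: P_def f_def A_def)
      moreover have "r s > 0" using r s by (simp add: RotSym_def)
      ultimately show ?thesis using K1 by simp
    qed
    have "lipschitz_distance
       (rot_space 0 :: (real \<times> (real ^ 'n)) set) (rot_dist 0 r)
       (rot_space (f 0) :: (real \<times> (real ^ 'n)) set) (rot_dist (f 0) P) \<le> ereal (2 * ln K)"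
    proof (rule radial_map_lipschitz_distance[OF _ f_deriv f'_cont f'_pos])
      show "1 \<le> K * f' s" for s
        using inv_K mult_left_mono[OF f'_ge[of s], of K] K1 by linarith
    qed (use n K1 f'_le r RotSym_continuous[OF r] radii Pf_cont in \<open>auto simp: RotSym_def\<close>)
    moreover have "f 0 = - L" using s1 by (simp add: f_def q_def)
    ultimately show ?thesis by (simp add: L_def P_def m_def)
  qed
qed

theorem theorem1p4:
  fixes \<epsilon> :: real
  assumes "CARD('n::finite) \<ge> 3" and "\<epsilon> > 0"
  shows "\<exists>\<delta>>0. \<forall>r.
    RotSym CARD('n) r \<longrightarrow>
    matching_radius CARD('n) r \<in> r ` {0..} \<longrightarrow>
    ADM_mass CARD('n) r \<le>
      ereal ((1 + \<delta>) / 2 * (boundary_area CARD('n) r / unit_sphere_area CARD('n))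
               powr ((real CARD('n) - 2) / (real CARD('n) - 1))) \<longrightarrow>
    (let m0 = boundary_mass CARD('n) r; L = depth CARD('n) r in
      lipschitz_distance
        (rot_space 0 :: (real \<times> (real ^ 'n)) set) (rot_dist 0 r)
        (rot_space (- L) :: (real \<times> (real ^ 'n)) set)
        (rot_dist (- L) (appended_sch_profile CARD('n) m0))
      < ereal \<epsilon>)"
proof -
  (* Any K > 1 with 2 * ln K < \<epsilon> would do. The mass excess will be at most \<eta> ^ 4. *)
  define K where "K = exp (\<epsilon> / 3)"
  define \<eta> where "\<eta> = min (1 / 2) ((K - 1) / 3)"
  have "K > 1" using assms(2) by (simp add: K_def)
  then have "0 < \<eta>" "\<eta> \<le> 1 / 2" "\<eta> \<le> (K - 1) / 3"
    unfolding \<eta>_def by (simp_all only: min.cobounded1 min.cobounded2) simp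
  then have \<eta>: "0 < \<eta>" "\<eta> \<le> 1 / 2" "1 + 3 * \<eta> \<le> K" by auto
  show ?thesis
  proof (intro exI[of _ "\<eta> ^ 4"] conjI allI impI)
    show "0 < \<eta> ^ 4" using \<eta> by simp
    fix r
    assume r: "RotSym CARD('n) r" and match: "matching_radius CARD('n) r \<in> r ` {0..}"
      and "ADM_mass CARD('n) r \<le>
        ereal ((1 + \<eta> ^ 4) / 2 * (boundary_area CARD('n) r / unit_sphere_area CARD('n))
                 powr ((real CARD('n) - 2) / (real CARD('n) - 1)))"
    then have fin: "ADM_mass CARD('n) r \<le> ereal ((1 + \<eta> ^ 4) * boundary_mass CARD('n) r)"
      by (simp add: boundary_mass_def)
    have "ereal (2 * ln K) < ereal \<epsilon>" using assms(2) by (simp add: K_def)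
    from le_less_trans[OF schwarzschild_distance_bound[OF assms(1) r fin match \<eta>(1,2) order_refl \<eta>(3)] this]
    show "let m0 = boundary_mass CARD('n) r; L = depth CARD('n) r in
      lipschitz_distance
        (rot_space 0 :: (real \<times> (real ^ 'n)) set) (rot_dist 0 r)
        (rot_space (- L) :: (real \<times> (real ^ 'n)) set)
        (rot_dist (- L) (appended_sch_profile CARD('n) m0))
      < ereal \<epsilon>"
      unfolding Let_def .
  qed
qed

end
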